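(* There exist (non-random) constants $0<\gamma_-\le\gamma_+<\infty$ such that $$\gamma_-\ \le\ \limsup_{N\to\infty}\ \frac1{\log N}\max_{1\le k\le N}\Lambda_k\ \le\ \gamma_+\qquad P\text{-almost surely},$$ where $\Lambda_k=\sum_{i=m_k}^{m_{k+1}-1}e^{-[V(i)-V(b_k)]}$ is the effective width of the $k$-th valley.
   Context: $\mathbb Z_+=\{0,1,2,\dots\}$. Let $\omega=(\omega_x)_{x\in\mathbb Z_+}$ be i.i.d. random variables with values in $(0,1)$; the law of $\omega$ is $P$ (expectation $E$). For $i\ge1$ put $\rho_i=(1-\omega_i)/\omega_i$. Standing assumptions: $E(\log\rho_1)=0$; $\mathrm{Var}(\log\rho_1)>0$; there is $\delta\in(0,1)$ with $P(\delta\le\omega_1\le1-\delta)=1$. Potential: $V(0)=0$, $V(x)=\sum_{i=1}^x\log\rho_i$ for $x\ge1$. Valleys: fix a constant $K_0>0$. Let $\eta_0=\inf\{i>0: V(i)-\min_{0\le j\le i}V(j)\ge K_0\}$ and $b_0=\sup\{i<\eta_0: V(i)=\min_{0\le j\le\eta_0}V(j)\}$. Inductively for $k\ge1$: $\theta_k=\inf\{i>\eta_{k-1}: V(i)\le V(b_{k-1})\}$; $H_{k-1}^+=\max_{\eta_{k-1}\le j\le\theta_k}V(j)-V(b_{k-1})$; $\eta_k=\inf\{i>\theta_k: V(i)-\min_{0\le j\le i}V(j)\ge H_{k-1}^+\}$; $b_k=\sup\{i<\eta_k: V(i)=\min_{\theta_k\le j\le\eta_k}V(j)\}$ (the bottom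 of the $k$-th valley). The beginning of the $k$-th valley ($k\ge1$) is $m_k=\inf\{i\ge\eta_{k-1}: V(i)=\max_{\eta_{k-1}\le j\le\theta_k}V(j)\}$. (All these quantities are $P$-a.s. finite.) *)

theory Defs
  imports "HOL-Probability.Probability"
begin

definition rho :: "(nat \<Rightarrow> real) \<Rightarrow> nat \<Rightarrow> real" where
  "rho e i = (1 - e i) / e i"

definition potential :: "(nat \<Rightarrow> real) \<Rightarrow> nat \<Rightarrow> real" where
  "potential e x = (\<Sum>i=1..x. ln (rho e i))"

text \<open>
  Valleys of a fixed path \<open>V\<close>, with \<open>c\<close> in the role of the constant \<open>K\<^sub>0\<close>.
  Infima and suprema are taken in the naturals, so that \<open>Inf {} = Sup {} = 0\<close>; for the random
  potential all sets involved are almost surely nonempty, hence these values are irrelevant.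
  The value \<open>valley_theta c V 0\<close> is a placeholder: the times \<open>\<theta>\<^sub>k\<close> exist for \<open>k \<ge> 1\<close> only.
  \<open>valley_H c V k\<close> is \<open>H\<^sub>k\<^sup>+\<close>, which depends on \<open>\<theta>\<close> at \<open>k + 1\<close>.
\<close>

function valley_eta :: "real \<Rightarrow> (nat \<Rightarrow> real) \<Rightarrow> nat \<Rightarrow> nat"
  and valley_bottom :: "real \<Rightarrow> (nat \<Rightarrow> real) \<Rightarrow> nat \<Rightarrow> nat"
  and valley_theta :: "real \<Rightarrow> (nat \<Rightarrow> real) \<Rightarrow> nat \<Rightarrow> nat"
  and valley_H :: "real \<Rightarrow> (nat \<Rightarrow> real) \<Rightarrow> nat \<Rightarrow> real"
where
  "valley_eta c V 0 = Inf {i. i > 0 \<and> V i - Min (V ` {0..i}) \<ge> c}"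
| "valley_eta c V (Suc k) =
     Inf {i. i > valley_theta c V (Suc k) \<and> V i - Min (V ` {0..i}) \<ge> valley_H c V k}"
| "valley_bottom c V 0 =
     Sup {i. i < valley_eta c V 0 \<and> V i = Min (V ` {0..valley_eta c V 0})}"
| "valley_bottom c V (Suc k) =
     Sup {i. i < valley_eta c V (Suc k) \<and>
             V i = Min (V ` {valley_theta c V (Suc k)..valley_eta c V (Suc k)})}"
| "valley_theta c V 0 = 0"
| "valley_theta c V (Suc k) =
     Inf {i. i > valley_eta c V k \<and> V i \<le> V (valley_bottom c V k)}"
| "valley_H c V k =
     Max (V ` {valley_eta c V k..valley_theta c V (Suc k)}) - V (valley_bottom c V k)"
  by pat_completeness auto
termination
  by (relation "Wellfounded.measure (\<lambda>s. case s of
        Inl (Inl (c, V, k)) \<Rightarrow> 4 * k + 2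
      | Inl (Inr (c, V, k)) \<Rightarrow> 4 * k + 3
      | Inr (Inl (c, V, k)) \<Rightarrow> 4 * k
      | Inr (Inr (c, V, k)) \<Rightarrow> 4 * k + 5)") auto

text \<open>Beginning of the \<open>k\<close>-th valley and its effective width; meaningful for \<open>k \<ge> 1\<close>.\<close>

definition valley_begin :: "real \<Rightarrow> (nat \<Rightarrow> real) \<Rightarrow> nat \<Rightarrow> nat" where
  "valley_begin c V k =
     Inf {i. i \<ge> valley_eta c V (k - 1) \<and>
             V i = Max (V ` {valley_eta c V (k - 1)..valley_theta c V k})}"

definition effective_width :: "real \<Rightarrow> (nat \<Rightarrow> real) \<Rightarrow> nat \<Rightarrow> real" where
  "effective_width c V k =
     (\<Sum>i\<in>{valley_begin c V k..<valley_begin c V (k + 1)}. exp (- (V i - V (valley_bottom c V k))))"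

end

theory Submission
  imports Defs
begin

text \<open>
  The potential is a random walk with bounded, centred, nondegenerate steps. Its elevation above
  the running minimum, together with the index of the current excursion and the height that has to
  be exceeded next, is a Markov chain, and every time and level occurring in the valleys can be
  read off its trajectory. Both bounds are obtained by exhibiting nonnegative supermartingales
  of this chain.

  Upper bound: \<open>E (exp (- X / 2)) > 1\<close> for a step \<open>X\<close>, so \<open>- exp (- r / 2)\<close> has a strict drift of order
  \<open>exp (- r / 2)\<close>, more than what a site at elevation \<open>r\<close> adds to the width. A correction by this
  function makes \<open>exp (a w)\<close> a supermartingale, \<open>w\<close> being the accumulated width, so that the widths
  have a uniform exponential moment and the first Borel--Cantelli lemma applies.

  Lower bound: started at a new minimum, the walk spends \<open>t\<close> consecutive steps near that minimum and
  then climbs to the barrier \<open>H\<close> with probability at least of order \<open>p ^ t / H\<close>; as each new minimum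
  before the barrier offers another attempt, and these are of order \<open>H\<close> in number, the \<open>k\<close>-th valley
  contains such a stretch with conditional probability at least of order \<open>p ^ t\<close>. For
  \<open>t = ln k / ln (1 / p)\<close> these probabilities are of order \<open>1 / k\<close>, whose sum diverges.
\<close>

section \<open>Markov chains driven by independent steps\<close>

text \<open>Both \<open>m_k\<close> and the level of \<open>b_k\<close> look into the future, so the
  width as it stands is not a functional of a Markov chain up to the present. Since
  \<open>m_k\<close> lies between \<open>\<eta>_{k-1}\<close> and \<open>\<theta>_k\<close>, the sum
  over [\<open>\<eta>_{k-1}\<close>, \<open>\<theta>_{k+1}\<close>) bounds the width from above and
  the sum over [\<open>\<theta>_k\<close>, \<open>\<eta>_k\<close>) from below. The level of the
  bottom is replaced by the current running minimum; when that minimum moves down by -z, the sum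
  accumulated so far is multiplied by exp z, so it can be carried along in the state. The barrier is
  random and grows, hence all constants must be uniform in \<open>H\<close>. Every supermartingale
  property is an inequality for one integral against the step law. Neither filtrations nor
  conditional expectations occur.\<close>

primrec run :: "('s \<Rightarrow> real \<Rightarrow> 's) \<Rightarrow> 's \<Rightarrow> (nat \<Rightarrow> real) \<Rightarrow> nat \<Rightarrow> 's" where
  "run f s x 0 = s"
| "run f s x (Suc n) = f (run f s x n) (x n)"

lemma run_case_nat: "run f s (case_nat y x) (Suc n) = run f (f s y) x n"
  by (induction n) auto

lemma run_measurable:
  assumes [measurable]: "(\<lambda>(s, y). f s y) \<in> R \<Otimes>\<^sub>M borel \<rightarrow>\<^sub>M R" and s: "s \<in> space R"
    and N: "\<And>i. (\<lambda>x. x i) \<in> N \<rightarrow>\<^sub>M borel"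
  shows "(\<lambda>x. run f s x n) \<in> N \<rightarrow>\<^sub>M R"
proof (induction n)
  case 0
  then show ?case using s by simp
next
  case (Suc n)
  note [measurable] = Suc N
  have "(\<lambda>x. (\<lambda>(s, y). f s y) (run f s x n, x n)) \<in> N \<rightarrow>\<^sub>M R"
    by measurable
  then show ?case by simp
qed

lemma run_invariant:
  assumes "Inv s" and "\<And>s y. Inv s \<Longrightarrow> \<bar>y\<bar> \<le> (L::real) \<Longrightarrow> Inv (f s y)" and "\<And>i. \<bar>x i\<bar> \<le> L"
  shows "Inv (run f s x n)"
  by (induction n) (use assms in auto)

locale walk = prob_space \<mu> for \<mu> :: "real measure" +
  fixes L :: real
  assumes sets_step: "sets \<mu> = sets borel"
    and L_pos: "L > 0"
    and step_bounded: "AE y in \<mu>. \<bar>y\<bar> \<le> L"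
    and step_mean: "(\<integral>y. y \<partial>\<mu>) = 0"
    and step_nondegenerate: "\<not> (AE y in \<mu>. y = 0)"

sublocale walk \<subseteq> seq: sequence_space \<mu>
  by unfold_locales

context walk
begin

abbreviation "S \<equiv> seq.S"

declare sets_step [measurable_cong]

lemma space_step [simp]: "space \<mu> = UNIV"
  using sets_eq_imp_space_eq[OF sets_step] by simp

lemma measure_UNIV [simp]: "measure \<mu> UNIV = 1"
  using prob_space by simp

lemma coordinate_measurable: "(\<lambda>x. x i) \<in> S \<rightarrow>\<^sub>M borel"
proof -
  have "(\<lambda>x. x i) \<in> S \<rightarrow>\<^sub>M \<mu>" by simp
  then show ?thesis by (simp cong: measurable_cong_sets add: sets_step)
qed

lemma AE_all_steps_bounded: "AE x in S. \<forall>i. \<bar>x i\<bar> \<le> L"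
  unfolding AE_all_countable
  by (intro allI AE_PiM_component step_bounded) (auto intro: prob_space_axioms)

lemma bounded_integrable:
  fixes h :: "real \<Rightarrow> real"
  assumes [measurable]: "h \<in> borel_measurable borel" and "\<And>y. \<bar>y\<bar> \<le> L \<Longrightarrow> \<bar>h y\<bar> \<le> B"
  shows "integrable \<mu> h"
proof -
  have "AE y in \<mu>. norm (h y) \<le> B"
    by (rule eventually_mono[OF step_bounded]) (use assms in auto)
  then show ?thesis by (rule integrable_const_bound) measurable
qed

lemma integrable_step [simp]: "integrable \<mu> (\<lambda>y. y)"
  by (rule bounded_integrable[where B=L]) auto

lemma nn_integral_le_bound:
  fixes h k :: "real \<Rightarrow> real"
  assumes "integrable \<mu> k" and "(\<integral>y. k y \<partial>\<mu>) \<le> c"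
    and "\<And>y. \<bar>y\<bar> \<le> L \<Longrightarrow> 0 \<le> h y \<and> h y \<le> k y"
  shows "(\<integral>\<^sup>+y. ennreal (h y) \<partial>\<mu>) \<le> ennreal c"
proof -
  have "(\<integral>\<^sup>+y. ennreal (h y) \<partial>\<mu>) \<le> (\<integral>\<^sup>+y. ennreal (k y) \<partial>\<mu>)"
    by (intro nn_integral_mono_AE eventually_mono[OF step_bounded] ennreal_leI) (use assms(3) in auto)
  also have "\<dots> = ennreal (\<integral>y. k y \<partial>\<mu>)"
    by (rule nn_integral_eq_integral[OF assms(1)], rule eventually_mono[OF step_bounded])
       (use assms(3) in force)
  also have "\<dots> \<le> ennreal c" using assms(2) by (rule ennreal_leI)
  finally show ?thesis .
qed

lemma nn_integral_iter:
  assumes [measurable]: "g \<in> borel_measurable S"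
  shows "(\<integral>\<^sup>+x. g x \<partial>S) = (\<integral>\<^sup>+y. \<integral>\<^sup>+x. g (case_nat y x) \<partial>S \<partial>\<mu>)"
proof -
  have "(\<integral>\<^sup>+x. g x \<partial>S) = (\<integral>\<^sup>+x. g x \<partial>distr (\<mu> \<Otimes>\<^sub>M S) S (\<lambda>(s, \<omega>). case_nat s \<omega>))"
    by (simp add: seq.PiM_iter)
  also have "\<dots> = (\<integral>\<^sup>+z. g (case z of (s, \<omega>) \<Rightarrow> case_nat s \<omega>) \<partial>(\<mu> \<Otimes>\<^sub>M S))"
    by (subst nn_integral_distr) measurable
  also have "\<dots> = (\<integral>\<^sup>+y. \<integral>\<^sup>+x. g (case_nat y x) \<partial>S \<partial>\<mu>)"
    by (subst seq.P.nn_integral_fst[symmetric]) auto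
  finally show ?thesis .
qed

text \<open>Induction over the first step, not the last: \<open>nn_integral_iter\<close> splits off
  the first coordinate, the induction hypothesis at the new state bounds the inner integral, and
  \<open>step\<close> bounds what remains.\<close>

lemma run_nn_integral_le:
  fixes \<Phi> :: "'s \<Rightarrow> real"
  assumes f [measurable]: "(\<lambda>(s, y). f s y) \<in> R \<Otimes>\<^sub>M borel \<rightarrow>\<^sub>M R" and R: "space R = UNIV"
    and \<Phi> [measurable]: "\<Phi> \<in> borel_measurable R"
    and Inv: "\<And>s y. Inv s \<Longrightarrow> \<bar>y\<bar> \<le> L \<Longrightarrow> Inv (f s y)"
    and step: "\<And>s. Inv s \<Longrightarrow> (\<integral>\<^sup>+y. ennreal (\<Phi> (f s y)) \<partial>\<mu>) \<le> ennreal (\<Phi> s)"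
    and s: "Inv s"
  shows "(\<integral>\<^sup>+x. ennreal (\<Phi> (run f s x n)) \<partial>S) \<le> ennreal (\<Phi> s)"
  using s
proof (induction n arbitrary: s)
  case 0
  then show ?case by (simp add: seq.P.emeasure_space_1)
next
  case (Suc n)
  have [measurable]: "(\<lambda>x. run f s x n) \<in> S \<rightarrow>\<^sub>M R" for s n
    by (rule run_measurable[OF f]) (auto simp: R coordinate_measurable)
  have "(\<integral>\<^sup>+x. ennreal (\<Phi> (run f s x (Suc n))) \<partial>S)
      = (\<integral>\<^sup>+y. \<integral>\<^sup>+x. ennreal (\<Phi> (run f (f s y) x n)) \<partial>S \<partial>\<mu>)"
    by (subst nn_integral_iter) (auto simp: run_case_nat simp del: run.simps)
  also have "\<dots> \<le> (\<integral>\<^sup>+y. ennreal (\<Phi> (f s y)) \<partial>\<mu>)"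
    by (intro nn_integral_mono_AE eventually_mono[OF step_bounded] Suc.IH Inv Suc.prems)
  also have "\<dots> \<le> ennreal (\<Phi> s)" using Suc.prems by (rule step)
  finally show ?case .
qed

lemma run_prob_le:
  fixes \<Phi> :: "'s \<Rightarrow> real"
  assumes f [measurable]: "(\<lambda>(s, y). f s y) \<in> R \<Otimes>\<^sub>M borel \<rightarrow>\<^sub>M R" and R: "space R = UNIV"
    and \<Phi> [measurable]: "\<Phi> \<in> borel_measurable R"
    and Inv: "\<And>s y. Inv s \<Longrightarrow> \<bar>y\<bar> \<le> L \<Longrightarrow> Inv (f s y)"
    and step: "\<And>s. Inv s \<Longrightarrow> (\<integral>\<^sup>+y. ennreal (\<Phi> (f s y)) \<partial>\<mu>) \<le> ennreal (\<Phi> s)"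
    and s: "Inv s"
    and T [measurable]: "Measurable.pred R T"
    and a: "0 < a" "\<And>s. Inv s \<Longrightarrow> T s \<Longrightarrow> a \<le> \<Phi> s" and \<Phi>s: "0 \<le> \<Phi> s"
  shows "measure S {x \<in> space S. T (run f s x n)} \<le> \<Phi> s / a"
proof -
  have [measurable]: "(\<lambda>x. run f s x n) \<in> S \<rightarrow>\<^sub>M R"
    by (rule run_measurable[OF f]) (auto simp: R coordinate_measurable)
  have "emeasure S {x \<in> space S. T (run f s x n)} = (\<integral>\<^sup>+x. indicator {x \<in> space S. T (run f s x n)} x \<partial>S)"
    by simp
  also have "\<dots> \<le> (\<integral>\<^sup>+x. ennreal (1 / a) * ennreal (\<Phi> (run f s x n)) \<partial>S)"
  proof (rule nn_integral_mono_AE, rule eventually_mono[OF AE_all_steps_bounded])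
    fix x :: "nat \<Rightarrow> real" assume x: "\<forall>i. \<bar>x i\<bar> \<le> L"
    have I: "Inv (run f s x n)"
      by (rule run_invariant[of Inv, OF s Inv]) (use x in auto)
    show "indicator {x \<in> space S. T (run f s x n)} x \<le> ennreal (1 / a) * ennreal (\<Phi> (run f s x n))"
    proof (cases "T (run f s x n)")
      case True
      then have "1 \<le> 1 / a * \<Phi> (run f s x n)" "0 \<le> \<Phi> (run f s x n)"
        using a(2)[OF I] a(1) by (auto simp: field_simps)
      then show ?thesis using a(1) by (auto simp: indicator_def ennreal_mult[symmetric] ennreal_ge_1)
    qed (auto simp: indicator_def)
  qed
  also have "\<dots> = ennreal (1 / a) * (\<integral>\<^sup>+x. ennreal (\<Phi> (run f s x n)) \<partial>S)"
    by (rule nn_integral_cmult) measurable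
  also have "\<dots> \<le> ennreal (1 / a) * ennreal (\<Phi> s)"
    by (intro mult_left_mono run_nn_integral_le[OF f R \<Phi> Inv step s]) auto
  also have "\<dots> = ennreal (\<Phi> s / a)"
    using a(1) \<Phi>s by (subst ennreal_mult[symmetric]) auto
  finally show ?thesis
    using a(1) \<Phi>s by (simp add: seq.P.emeasure_eq_measure ennreal_le_iff)
qed

text \<open>For absorbing \<open>T\<close> the events at fixed times increase, so Markov's
  inequality at each time already bounds the probability of ever entering \<open>T\<close>. This
  takes the place of optional stopping.\<close>

lemma run_absorbing_prob_le:
  fixes \<Phi> :: "'s \<Rightarrow> real"
  assumes f [measurable]: "(\<lambda>(s, y). f s y) \<in> R \<Otimes>\<^sub>M borel \<rightarrow>\<^sub>M R" and R: "space R = UNIV"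
    and \<Phi> [measurable]: "\<Phi> \<in> borel_measurable R"
    and Inv: "\<And>s y. Inv s \<Longrightarrow> \<bar>y\<bar> \<le> L \<Longrightarrow> Inv (f s y)"
    and step: "\<And>s. Inv s \<Longrightarrow> (\<integral>\<^sup>+y. ennreal (\<Phi> (f s y)) \<partial>\<mu>) \<le> ennreal (\<Phi> s)"
    and s: "Inv s"
    and T [measurable]: "Measurable.pred R T"
    and a: "0 < a" "\<And>s. Inv s \<Longrightarrow> T s \<Longrightarrow> a \<le> \<Phi> s" and \<Phi>s: "0 \<le> \<Phi> s"
    and absorbing: "\<And>s y. T s \<Longrightarrow> T (f s y)"
  shows "measure S {x \<in> space S. \<exists>n. T (run f s x n)} \<le> \<Phi> s / a"
proof -
  have [measurable]: "(\<lambda>x. run f s x n) \<in> S \<rightarrow>\<^sub>M R" for n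
    by (rule run_measurable[OF f]) (auto simp: R coordinate_measurable)
  let ?A = "\<lambda>n. {x \<in> space S. T (run f s x n)}"
  have "incseq ?A"
    by (rule incseq_SucI) (auto intro: absorbing)
  then have "(\<lambda>n. measure S (?A n)) \<longlonglongrightarrow> measure S (\<Union>n. ?A n)"
    by (intro seq.P.finite_Lim_measure_incseq) auto
  then have "measure S (\<Union>n. ?A n) \<le> \<Phi> s / a"
    by (rule LIMSEQ_le_const2)
       (use run_prob_le[OF f R \<Phi> Inv step s T a \<Phi>s] in auto)
  also have "(\<Union>n. ?A n) = {x \<in> space S. \<exists>n. T (run f s x n)}" by auto
  finally show ?thesis .
qed

section \<open>Strict convexity and two-sided tails of the step law\<close>

lemma exp_step_mean_gt_1: "(\<integral>y. exp (- y / 2) \<partial>\<mu>) > 1"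
proof -
  have int: "integrable \<mu> (\<lambda>y. exp (- y / 2))"
    by (rule bounded_integrable[where B="exp (L / 2)"]) (auto simp: abs_le_iff)
  \<comment> \<open>Strict Jensen by hand: \<open>?h\<close> is nonnegative with its only zero at 0,
    and its mean is the excess over 1 because the step is centred.\<close>
  let ?h = "\<lambda>y::real. exp (- y / 2) - 1 + y / 2"
  have pos: "0 < ?h y" if "y \<noteq> 0" for y :: real
    using exp_minus_greater[of "y/2"] exp_ge_add_one_self[of "-y/2"] that by auto
  have pos0: "0 \<le> ?h y" for y :: real
    using pos[of y] by (cases "y = 0") auto
  have "integrable \<mu> ?h" using int by auto
  moreover have "(\<integral>y. ?h y \<partial>\<mu>) = (\<integral>y. exp (- y / 2) \<partial>\<mu>) - 1"
    using int by (simp add: step_mean)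
  moreover have "(\<integral>y. ?h y \<partial>\<mu>) \<noteq> 0"
  proof
    assume "(\<integral>y. ?h y \<partial>\<mu>) = 0"
    then have "AE y in \<mu>. ?h y = 0"
      using \<open>integrable \<mu> ?h\<close> pos0 by (subst (asm) integral_nonneg_eq_0_iff_AE) auto
    then have "AE y in \<mu>. y = 0" by (rule eventually_mono) (use pos in force)
    then show False using step_nondegenerate by simp
  qed
  moreover have "(\<integral>y. ?h y \<partial>\<mu>) \<ge> 0" using pos0 by simp
  ultimately show ?thesis by linarith
qed

lemma step_variance_pos: "(\<integral>y. y\<^sup>2 \<partial>\<mu>) > 0"
proof -
  have "integrable \<mu> (\<lambda>y. y\<^sup>2)"
    by (rule bounded_integrable[where B="L\<^sup>2"]) (auto simp: abs_le_square_iff[symmetric] L_pos)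
  then have "(\<integral>y. y\<^sup>2 \<partial>\<mu>) \<noteq> 0"
    using step_nondegenerate by (subst integral_nonneg_eq_0_iff_AE) auto
  moreover have "(\<integral>y. y\<^sup>2 \<partial>\<mu>) \<ge> 0" by simp
  ultimately show ?thesis by linarith
qed

text \<open>Otherwise \<open>s * y\<close> would be nonpositive almost surely, and a centred
  variable of constant sign vanishes.\<close>

lemma step_tails_pos:
  assumes "s = 1 \<or> s = -1"
  shows "\<exists>e>0. measure \<mu> {y. s * y \<ge> e} > 0"
proof (rule ccontr)
  assume "\<not> ?thesis"
  then have *: "emeasure \<mu> {y. s * y \<ge> e} = 0" if "e > 0" for e
    using that by (auto simp: zero_less_measure_iff emeasure_eq_measure)
  have "AE y in \<mu>. s * y < inverse (real (Suc n))" for n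
    by (rule AE_I[of _ _ "{y. s * y \<ge> inverse (real (Suc n))}"])
       (use *[of "inverse (real (Suc n))"] in \<open>auto simp: not_less\<close>)
  then have "AE y in \<mu>. \<forall>n. s * y < inverse (real (Suc n))"
    by (simp add: AE_all_countable)
  then have le: "AE y in \<mu>. 0 \<le> - (s * y)"
  proof (rule eventually_mono)
    fix y assume "\<forall>n. s * y < inverse (real (Suc n))"
    then have "\<not> 0 < s * y" using reals_Archimedean[of "s * y"] by (meson less_asym)
    then show "0 \<le> - (s * y)" by simp
  qed
  have "(\<integral>y. - (s * y) \<partial>\<mu>) = 0" by (simp add: step_mean)
  then have "AE y in \<mu>. - (s * y) = 0"
    using le by (subst (asm) integral_nonneg_eq_0_iff_AE) auto
  then have "AE y in \<mu>. y = 0" by (rule eventually_mono) (use assms in auto)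
  then show False using step_nondegenerate by simp
qed

lemma step_tails:
  obtains e p where "0 < e" "e \<le> L" "0 < p" "p < 1"
    "measure \<mu> {y. y \<ge> e} \<ge> p" "measure \<mu> {y. y \<le> - e} \<ge> p"
proof -
  obtain a b where a: "a > 0" "measure \<mu> {y. y \<ge> a} > 0" and b: "b > 0" "measure \<mu> {y. y \<le> - b} > 0"
    using step_tails_pos[of 1] step_tails_pos[of "-1"] by (auto simp: le_minus_iff)
  define e where "e = Min {a, b, L}"
  define p where "p = Min {measure \<mu> {y. y \<ge> a}, measure \<mu> {y. y \<le> - b}, 1/2}"
  have "measure \<mu> {y. y \<ge> a} \<le> measure \<mu> {y. y \<ge> e}"
    by (rule finite_measure_mono) (auto simp: e_def sets_step)
  moreover have "measure \<mu> {y. y \<le> - b} \<le> measure \<mu> {y. y \<le> - e}"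
    by (rule finite_measure_mono) (auto simp: e_def sets_step)
  ultimately show thesis
    by (intro that[of e p]) (use a b L_pos in \<open>auto simp: e_def p_def min_le_iff_disj\<close>)
qed

end

section \<open>Oscillation of the walk\<close>

definition walk_pos :: "(nat \<Rightarrow> real) \<Rightarrow> nat \<Rightarrow> real" where
  "walk_pos x n = (\<Sum>i<n. x i)"

lemma walk_pos_0 [simp]: "walk_pos x 0 = 0"
  and walk_pos_Suc [simp]: "walk_pos x (Suc n) = walk_pos x n + x n"
  by (simp_all add: walk_pos_def)

text \<open>
  Position, time and status of the walk with steps \<open>\<sigma> * y\<close>: status \<open>1\<close> once it has reached
  \<open>[N, \<infinity>)\<close>, status \<open>2\<close> once it has reached \<open>(-\<infinity>, -h]\<close>.
\<close>

definition exit_step :: "real \<Rightarrow> real \<Rightarrow> real \<Rightarrow> real \<times> real \<times> nat \<Rightarrow> real \<Rightarrow> real \<times> real \<times> nat" where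
  "exit_step \<sigma> h N s y = (if snd (snd s) = 0
     then (fst s + \<sigma> * y, fst (snd s) + 1,
           if fst s + \<sigma> * y \<ge> N then 1 else if fst s + \<sigma> * y \<le> - h then 2 else 0)
     else s)"

lemma exit_step_run:
  "case run (exit_step \<sigma> h N) (0, 0, 0) x n of (v, m, b) \<Rightarrow>
     (b = 0 \<longrightarrow> v = \<sigma> * walk_pos x n \<and> m = real n) \<and> (b = 1 \<longrightarrow> (\<exists>i. N \<le> \<sigma> * walk_pos x i))"
proof (induction n)
  case 0
  show ?case by simp
next
  case (Suc n)
  obtain v m b where r: "run (exit_step \<sigma> h N) (0, 0, 0) x n = (v, m, b)"
    by (metis prod_cases3)
  have "\<exists>i. N \<le> \<sigma> * walk_pos x i" if "N \<le> \<sigma> * walk_pos x n + \<sigma> * x n"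
    using that by (intro exI[of _ "Suc n"]) (simp add: algebra_simps)
  then show ?case using Suc by (auto simp: r exit_step_def algebra_simps)
qed

context walk
begin

text \<open>\<open>lin\<close> is the gambler's ruin martingale: at least 1 after an exit below, and
  still nonnegative after an exit above because the overshoot is at most \<open>L\<close>.
  \<open>quad\<close> is the martingale \<open>D\<^sup>2 - v\<^sup>2 + var * m\<close>, normalised
  to be at least 1 if no exit has occurred by time \<open>n\<close>. Their sum therefore dominates
  the indicator of not having reached \<open>N\<close> by time \<open>n\<close>, and its initial
  value is the bound.\<close>

lemma exit_above_prob:
  assumes \<sigma>: "\<sigma> = 1 \<or> \<sigma> = -1" and N: "N > 0" and h: "h > 0" and n: "n > 0"
  shows "measure S {x \<in> space S. \<forall>i. \<sigma> * walk_pos x i < N}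
    \<le> (N + L) / (N + L + h) + (N + L + h)\<^sup>2 / ((\<integral>y. y\<^sup>2 \<partial>\<mu>) * real n)"
proof -
  define var where "var = (\<integral>y. y\<^sup>2 \<partial>\<mu>)"
  have var: "var > 0" using step_variance_pos by (simp add: var_def)
  have int: "integrable \<mu> (\<lambda>y. y\<^sup>2)"
    by (rule bounded_integrable[where B="L\<^sup>2"]) (auto simp: abs_le_square_iff[symmetric] L_pos)
  define D where "D = N + L + h"
  have D: "D > 0" using N h L_pos by (simp add: D_def)
  have s2: "\<sigma>\<^sup>2 = 1" using \<sigma> by auto
  define lin where "lin v = (N + L - v) / D" for v
  define quad where "quad v m = (D\<^sup>2 - v\<^sup>2 + var * m) / (var * real n)" for v m
  define \<Phi> :: "real \<times> real \<times> nat \<Rightarrow> real" where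
    "\<Phi> s = (if snd (snd s) = 0 then lin (fst s) + quad (fst s) (fst (snd s))
            else if snd (snd s) = 1 then 0 else 1)" for s
  define Inv :: "real \<times> real \<times> nat \<Rightarrow> bool" where
    "Inv s \<longleftrightarrow> fst (snd s) \<ge> 0 \<and> (snd (snd s) = 0 \<longrightarrow> - h < fst s \<and> fst s < N)" for s
  define T :: "real \<times> real \<times> nat \<Rightarrow> bool" where
    "T s \<longleftrightarrow> snd (snd s) \<noteq> 1 \<and> (snd (snd s) = 0 \<longrightarrow> fst (snd s) \<ge> real n)" for s
  let ?R = "borel \<Otimes>\<^sub>M borel \<Otimes>\<^sub>M count_space UNIV :: (real \<times> real \<times> nat) measure"
  have sgn: "\<bar>\<sigma> * y\<bar> = \<bar>y\<bar>" for y using \<sigma> by auto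
  have quad_nonneg: "0 \<le> quad v m" if "\<bar>v\<bar> \<le> D" "m \<ge> 0" for v m
  proof -
    have "v\<^sup>2 \<le> D\<^sup>2" using that D by (simp add: abs_le_square_iff[symmetric])
    then show ?thesis using that var by (simp add: quad_def)
  qed
  have f: "(\<lambda>(s, y). exit_step \<sigma> h N s y) \<in> ?R \<Otimes>\<^sub>M borel \<rightarrow>\<^sub>M ?R"
    unfolding exit_step_def split_def by measurable
  have \<Phi>: "\<Phi> \<in> borel_measurable ?R"
    unfolding \<Phi>_def lin_def quad_def by measurable
  have T: "Measurable.pred ?R T"
    unfolding T_def by measurable
  have Inv_step: "Inv (exit_step \<sigma> h N s y)" if "Inv s" for s y
    using that by (auto simp: Inv_def exit_step_def)
  have step: "(\<integral>\<^sup>+y. ennreal (\<Phi> (exit_step \<sigma> h N s y)) \<partial>\<mu>) \<le> ennreal (\<Phi> s)" if I: "Inv s" for s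
  proof (cases "snd (snd s) = 0")
    case False
    then show ?thesis by (simp add: exit_step_def emeasure_eq_measure)
  next
    case True
    obtain v m where s: "s = (v, m, 0)" using True by (cases s) auto
    have v: "- h < v" "v < N" "m \<ge> 0" using I by (auto simp: Inv_def s)
    define k where "k y = lin (v + \<sigma> * y) + quad (v + \<sigma> * y) (m + 1)" for y
    have k_eq: "k y = \<Phi> s + 1 / real n - (\<sigma> / D + 2 * v * \<sigma> / (var * real n)) * y - y\<^sup>2 / (var * real n)" for y
      using var D n s2 by (simp add: k_def lin_def quad_def s \<Phi>_def power2_sum power_mult_distrib field_simps)
    show ?thesis
    proof (rule nn_integral_le_bound[where k=k])
      show "integrable \<mu> k"
        unfolding k_eq using int by (auto intro!: Bochner_Integration.integrable_diff)
      show "(\<integral>y. k y \<partial>\<mu>) \<le> \<Phi> s"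
        unfolding k_eq using int var by (simp add: step_mean var_def[symmetric])
    next
      fix y assume y: "\<bar>y\<bar> \<le> L"
      let ?v = "v + \<sigma> * y"
      have bd: "\<bar>?v\<bar> \<le> D" "?v \<le> N + L" using v y N h L_pos sgn[of y] by (auto simp: D_def)
      have "0 \<le> lin ?v" using bd D by (simp add: lin_def)
      moreover have "0 \<le> quad ?v (m + 1)" using bd v by (intro quad_nonneg) auto
      moreover have "1 \<le> lin ?v" if "?v \<le> - h" using that D by (simp add: lin_def D_def)
      ultimately show "0 \<le> \<Phi> (exit_step \<sigma> h N s y) \<and> \<Phi> (exit_step \<sigma> h N s y) \<le> k y"
        by (auto simp: s \<Phi>_def exit_step_def k_def)
    qed
  qed
  have a: "1 \<le> \<Phi> s" if "Inv s" "T s" for s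
  proof (cases "snd (snd s) = 0")
    case True
    have b: "fst s \<le> N" "\<bar>fst s\<bar> \<le> D" "real n \<le> fst (snd s)"
      using that True h N L_pos by (auto simp: Inv_def T_def D_def)
    have "(fst s)\<^sup>2 \<le> D\<^sup>2" using b D by (simp add: abs_le_square_iff[symmetric])
    moreover have "var * real n \<le> var * fst (snd s)" using b var by simp
    ultimately have "var * real n \<le> D\<^sup>2 - (fst s)\<^sup>2 + var * fst (snd s)" by linarith
    then have "1 \<le> quad (fst s) (fst (snd s))" unfolding quad_def by (subst le_divide_eq_1_pos) (use var n in auto)
    moreover have "0 \<le> lin (fst s)" using b L_pos D by (simp add: lin_def)
    ultimately show ?thesis using True by (simp add: \<Phi>_def)
  qed (use that in \<open>auto simp: \<Phi>_def T_def\<close>)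
  have \<Phi>0: "\<Phi> (0, 0, 0) = (N + L) / D + D\<^sup>2 / (var * real n)"
    by (simp add: \<Phi>_def lin_def quad_def)
  have [measurable]: "(\<lambda>x. run (exit_step \<sigma> h N) (0, 0, 0) x n) \<in> S \<rightarrow>\<^sub>M ?R"
    by (rule run_measurable[OF f]) (auto simp: coordinate_measurable space_pair_measure)
  have "measure S {x \<in> space S. \<forall>i. \<sigma> * walk_pos x i < N}
      \<le> measure S {x \<in> space S. T (run (exit_step \<sigma> h N) (0, 0, 0) x n)}"
  proof (rule seq.P.finite_measure_mono)
    show "{x \<in> space S. T (run (exit_step \<sigma> h N) (0, 0, 0) x n)} \<in> sets S"
      using T by measurable
    show "{x \<in> space S. \<forall>i. \<sigma> * walk_pos x i < N}
        \<subseteq> {x \<in> space S. T (run (exit_step \<sigma> h N) (0, 0, 0) x n)}"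
    proof safe
      fix x assume "\<forall>i. \<sigma> * walk_pos x i < N"
      then show "T (run (exit_step \<sigma> h N) (0, 0, 0) x n)"
        using exit_step_run[where x=x and n=n and h=h and N=N and \<sigma>=\<sigma>] by (auto simp: T_def split: prod.splits simp: not_le[symmetric])
    qed
  qed
  also have "\<dots> \<le> \<Phi> (0, 0, 0) / 1"
  proof (rule run_prob_le[where \<Phi>=\<Phi> and Inv=Inv, OF f _ \<Phi> Inv_step step _ T])
    show "0 \<le> \<Phi> (0, 0, 0)" unfolding \<Phi>0 using N L_pos D var by simp
  qed (use a N h in \<open>auto simp: Inv_def space_pair_measure\<close>)
  finally show ?thesis by (simp add: \<Phi>0 D_def var_def)
qed

lemma walk_pos_measurable [measurable]: "(\<lambda>x. walk_pos x i) \<in> borel_measurable S"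
  unfolding walk_pos_def by (intro borel_measurable_sum coordinate_measurable)

lemma AE_walk_unbounded_signed:
  assumes \<sigma>: "\<sigma> = 1 \<or> \<sigma> = -1"
  shows "AE x in S. \<forall>N::nat. \<exists>i. real N \<le> \<sigma> * walk_pos x i"
proof -
  have "AE x in S. \<exists>i. real N \<le> \<sigma> * walk_pos x i" for N
  proof -
    \<comment> \<open>The level is N + 1 so that it is positive even for N = 0, as
      \<open>exit_above_prob\<close> requires.\<close>
    let ?A = "{x \<in> space S. \<forall>i. \<sigma> * walk_pos x i < real N + 1}"
    let ?N = "real N + 1" and ?var = "\<integral>y. y\<^sup>2 \<partial>\<mu>"
    \<comment> \<open>First the time horizon tends to infinity at fixed \<open>h\<close>, which
      leaves the ruin probability; afterwards \<open>h\<close> does.\<close>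
    have le: "measure S ?A \<le> (?N + L) / (?N + L + h)" if h: "h > 0" for h
    proof (rule LIMSEQ_le_const[of "\<lambda>n. (?N + L) / (?N + L + h) + (?N + L + h)\<^sup>2 / (?var * real n)"])
      have "(\<lambda>n. (?N + L + h)\<^sup>2 / ?var * (1 / real n)) \<longlonglongrightarrow> (?N + L + h)\<^sup>2 / ?var * 0"
        by (intro tendsto_mult_left lim_1_over_n)
      then have "(\<lambda>n. (?N + L + h)\<^sup>2 / (?var * real n)) \<longlonglongrightarrow> 0" by simp
      from tendsto_add[OF tendsto_const this]
      show "(\<lambda>n. (?N + L) / (?N + L + h) + (?N + L + h)\<^sup>2 / (?var * real n)) \<longlonglongrightarrow> (?N + L) / (?N + L + h)"
        by simp
      show "\<exists>M. \<forall>n\<ge>M. measure S ?A \<le> (?N + L) / (?N + L + h) + (?N + L + h)\<^sup>2 / (?var * real n)"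
        by (intro exI[of _ 1] allI impI exit_above_prob \<sigma> h) auto
    qed
    have "measure S ?A \<le> 0"
    proof (rule LIMSEQ_le_const[of "\<lambda>n. (?N + L) / (?N + L + real n)"])
      have "filterlim (\<lambda>n. (?N + L) + real n) at_top sequentially"
        by (rule filterlim_tendsto_add_at_top[OF tendsto_const filterlim_real_sequentially])
      then show "(\<lambda>n. (?N + L) / (?N + L + real n)) \<longlonglongrightarrow> 0"
        by (intro tendsto_divide_0[OF tendsto_const] filterlim_at_top_imp_at_infinity) simp
      show "\<exists>M. \<forall>n\<ge>M. measure S ?A \<le> (?N + L) / (?N + L + real n)"
        by (intro exI[of _ 1] allI impI le) auto
    qed
    then have "emeasure S ?A = 0"
      by (simp add: seq.P.emeasure_eq_measure measure_le_0_iff)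
    moreover have "?A \<in> sets S" by measurable
    ultimately have "AE x in S. x \<notin> ?A" by (intro AE_not_in) (auto simp: null_sets_def)
    then show ?thesis
    proof (rule AE_mp, intro AE_I2 impI)
      fix x assume "x \<in> space S" "x \<notin> ?A"
      then obtain i where "\<not> \<sigma> * walk_pos x i < real N + 1" by auto
      then show "\<exists>i. real N \<le> \<sigma> * walk_pos x i" by (intro exI[of _ i]) linarith
    qed
  qed
  then show ?thesis by (simp add: AE_all_countable)
qed

end

section \<open>Phases of the potential and valleys\<close>

text \<open>
  The state \<open>(q, r, H)\<close> of the potential read from left to right: \<open>r\<close> is its elevation above the
  running minimum and \<open>H\<close> the elevation that the next \<open>\<eta>\<close> has to exceed; the phase is \<open>q = 2 k\<close> on
  \<open>[\<theta>\<^sub>k, \<eta>\<^sub>k)\<close>, with \<open>\<theta>\<^sub>0 = 0\<close>, and \<open>q = 2 k + 1\<close> on \<open>[\<eta>\<^sub>k, \<theta>\<^sub>k\<^sub>+\<^sub>1)\<close>.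
\<close>

definition next_phase :: "nat \<times> real \<times> real \<Rightarrow> real \<Rightarrow> nat" where
  "next_phase s y = (if even (fst s)
     then if max 0 (fst (snd s) + y) \<ge> snd (snd s) then Suc (fst s) else fst s
     else if fst (snd s) + y \<le> 0 then Suc (fst s) else fst s)"

text \<open>Testing the new phase lets the elevation at \<open>\<eta>_k\<close> itself enter the
  maximum, whereas the step to \<open>\<theta>_{k+1}\<close>, where the elevation is 0, leaves the
  barrier alone. Throughout an even phase the barrier is thus the height found in the preceding odd
  phase, or \<open>c\<close> at the start.\<close>

definition core_step :: "nat \<times> real \<times> real \<Rightarrow> real \<Rightarrow> nat \<times> real \<times> real" where
  "core_step s y = (next_phase s y, max 0 (fst (snd s) + y),
     if odd (next_phase s y) then max (snd (snd s)) (max 0 (fst (snd s) + y)) else snd (snd s))"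

definition core :: "real \<Rightarrow> (nat \<Rightarrow> real) \<Rightarrow> nat \<Rightarrow> nat \<times> real \<times> real" where
  "core c = run core_step (0, 0, c)"

definition phase :: "real \<Rightarrow> (nat \<Rightarrow> real) \<Rightarrow> nat \<Rightarrow> nat" where
  "phase c x n = fst (core c x n)"

definition elevation :: "real \<Rightarrow> (nat \<Rightarrow> real) \<Rightarrow> nat \<Rightarrow> real" where
  "elevation c x n = fst (snd (core c x n))"

definition barrier :: "real \<Rightarrow> (nat \<Rightarrow> real) \<Rightarrow> nat \<Rightarrow> real" where
  "barrier c x n = snd (snd (core c x n))"

lemma core_eq: "core c x n = (phase c x n, elevation c x n, barrier c x n)"
  by (simp add: phase_def elevation_def barrier_def)

lemma core_0 [simp]: "phase c x 0 = 0" "elevation c x 0 = 0" "barrier c x 0 = c"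
  by (simp_all add: phase_def elevation_def barrier_def core_def)

lemma phase_Suc: "phase c x (Suc n) = (if even (phase c x n)
     then if max 0 (elevation c x n + x n) \<ge> barrier c x n then Suc (phase c x n) else phase c x n
     else if elevation c x n + x n \<le> 0 then Suc (phase c x n) else phase c x n)"
  by (simp add: phase_def elevation_def barrier_def core_def core_step_def next_phase_def)

lemma elevation_Suc: "elevation c x (Suc n) = max 0 (elevation c x n + x n)"
  by (simp add: elevation_def core_def core_step_def)

lemma barrier_Suc: "barrier c x (Suc n) =
    (if odd (phase c x (Suc n)) then max (barrier c x n) (elevation c x (Suc n)) else barrier c x n)"
  by (simp add: phase_def elevation_def barrier_def core_def core_step_def)

section \<open>The walk reflected at its running minimum\<close>

definition run_min :: "(nat \<Rightarrow> real) \<Rightarrow> nat \<Rightarrow> real" where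
  "run_min V n = Min (V ` {0..n})"

lemma run_min_0 [simp]: "run_min V 0 = V 0"
  by (simp add: run_min_def)

lemma run_min_Suc: "run_min V (Suc n) = min (run_min V n) (V (Suc n))"
  by (simp add: run_min_def atLeast0_atMost_Suc min.commute)

lemma run_min_le: "i \<le> n \<Longrightarrow> run_min V n \<le> V i"
  by (simp add: run_min_def)

lemma elevation_eq: "elevation c x n = walk_pos x n - run_min (walk_pos x) n"
  by (induction n) (auto simp: elevation_Suc run_min_Suc)

lemma run_min_walk_Suc:
  "run_min (walk_pos x) (Suc n) = run_min (walk_pos x) n + min 0 (elevation c x n + x n)"
  by (auto simp: run_min_Suc elevation_eq)

lemma barrier_Suc_ge: "barrier c x n \<le> barrier c x (Suc n)"
  by (simp add: barrier_Suc)

lemma barrier_mono: "m \<le> n \<Longrightarrow> barrier c x m \<le> barrier c x n"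
  by (rule lift_Suc_mono_le[of "barrier c x"]) (rule barrier_Suc_ge)

lemma phase_Suc_cases: "phase c x (Suc n) = phase c x n \<or> phase c x (Suc n) = Suc (phase c x n)"
  by (simp add: phase_Suc)

lemma phase_mono: "m \<le> n \<Longrightarrow> phase c x m \<le> phase c x n"
proof (rule lift_Suc_mono_le[of "phase c x"])
  show "phase c x n \<le> phase c x (Suc n)" for n using phase_Suc_cases[of c x n] by auto
qed

lemma elevation_le_barrier:
  assumes "c > 0"
  shows "elevation c x n \<le> barrier c x n \<and> (even (phase c x n) \<longrightarrow> elevation c x n < barrier c x n)"
proof (induction n)
  case (Suc n)
  have "0 < barrier c x n" using barrier_mono[of 0 n c x] assms by simp
  then show ?case using Suc by (auto simp: phase_Suc elevation_Suc barrier_Suc)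
qed (use assms in simp)

definition oscillating :: "(nat \<Rightarrow> real) \<Rightarrow> bool" where
  "oscillating V \<longleftrightarrow> (\<forall>N::nat. \<exists>i. real N \<le> V i) \<and> (\<forall>N::nat. \<exists>i. real N \<le> - V i)"

section \<open>Phases along an oscillating path\<close>

locale valley_path =
  fixes c :: real and x :: "nat \<Rightarrow> real"
  assumes c_pos: "c > 0" and oscillating: "oscillating (walk_pos x)"
begin

abbreviation "V \<equiv> walk_pos x"
abbreviation "q \<equiv> phase c x"
abbreviation "r \<equiv> elevation c x"
abbreviation "H \<equiv> barrier c x"

lemma barrier_ge: "c \<le> H n"
  using barrier_mono[of 0 n c x] by simp

lemma barrier_unbounded: "\<exists>n. a \<le> H n"
proof -
  obtain N :: nat where "a \<le> real N" using real_arch_simple by blast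
  moreover obtain n where "real N \<le> V n" using oscillating by (auto simp: oscillating_def)
  \<comment> \<open>The path starts at 0, so its running minimum is never positive.\<close>
  moreover have "V n \<le> r n" using run_min_le[of 0 n V] by (simp add: elevation_eq)
  moreover have "r n \<le> H n" using elevation_le_barrier[OF c_pos] by simp
  ultimately show ?thesis by (intro exI[of _ n]) linarith
qed

text \<open>An endless even phase would freeze the barrier, which is unbounded because
  \<open>V\<close> is unbounded above; an endless odd phase would freeze the running minimum,
  although \<open>V\<close> is unbounded below.\<close>

lemma phase_advances: "\<exists>m>n. q n < q m"
proof (rule ccontr)
  assume none: "\<not> (\<exists>m>n. q n < q m)"
  have const: "q m = q n" if "m \<ge> n" for m
  proof -
    have "\<not> q n < q m" using none that by (metis le_neq_implies_less less_irrefl)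
    then show ?thesis using phase_mono[OF that, of c x] by linarith
  qed
  show False
  proof (cases "even (q n)")
    case True
    have H: "H m = H n" if "m \<ge> n" for m
      using that
    proof (induction m rule: dec_induct)
      case (step m)
      then have "even (q (Suc m))" using const[of "Suc m"] True by simp
      then show ?case using step by (simp add: barrier_Suc)
    qed simp
    obtain m where m: "H n + 1 \<le> H m" using barrier_unbounded by blast
    show False
    proof (cases "m \<ge> n")
      case True
      then show ?thesis using m H[OF True] by linarith
    next
      case False
      then show ?thesis using m barrier_mono[of m n c x] by simp
    qed
  next
    case False
    have pos: "0 < r m + x m" if "m \<ge> n" for m
    proof -
      have "q (Suc m) = q m" "odd (q m)" using const[of m] const[of "Suc m"] False that by simp_all
      then show ?thesis using phase_Suc[of c x m] by (simp split: if_splits)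
    qed
    have min: "run_min V m = run_min V n" if "m \<ge> n" for m
      using that
    proof (induction m rule: dec_induct)
      case (step m)
      then show ?case using pos[of m] by (simp add: run_min_walk_Suc[of x m c])
    qed simp
    obtain N :: nat where "- run_min V n < real N" using reals_Archimedean2 by blast
    moreover obtain m where "real N \<le> - V m" using oscillating by (auto simp: oscillating_def)
    ultimately have "V m < run_min V n" by linarith
    moreover have "run_min V n \<le> V m"
      using min[of "max m n"] run_min_le[of m "max m n" V] by simp
    ultimately show False by simp
  qed
qed

lemma phase_unbounded: "\<exists>n. j \<le> q n"
proof (induction j)
  case (Suc j)
  then obtain n where "j \<le> q n" by blast
  moreover obtain m where "q n < q m" using phase_advances by blast
  ultimately show ?case by (intro exI[of _ m]) simp
qed simp

text \<open>\<open>entry (2*k)\<close> will be \<open>\<theta>_k\<close> and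
  \<open>entry (2*k+1)\<close> will be \<open>\<eta>_k\<close>. The inequality in place of
  \<open>q n = j\<close> makes \<open>entry\<close> adjoint to the monotone phase
  (\<open>entry_le_iff\<close>); as the phase never skips a value, phase \<open>j\<close> is indeed
  met there.\<close>

definition entry :: "nat \<Rightarrow> nat" where
  "entry j = (LEAST n. j \<le> q n)"

lemma entry_le_iff: "entry j \<le> n \<longleftrightarrow> j \<le> q n"
proof
  assume "entry j \<le> n"
  moreover have "j \<le> q (entry j)" unfolding entry_def by (rule LeastI_ex) (rule phase_unbounded)
  ultimately show "j \<le> q n" using phase_mono le_trans by blast
qed (simp add: entry_def Least_le)

lemma entry_0 [simp]: "entry 0 = 0"
  using entry_le_iff[of 0 0] by simp

lemma phase_entry: "q (entry j) = j"
proof (cases "entry j")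
  case 0
  then show ?thesis using entry_le_iff[of j 0] by simp
next
  case (Suc n)
  then have "\<not> j \<le> q n" "j \<le> q (Suc n)" using entry_le_iff[of j n] entry_le_iff[of j "Suc n"] by auto
  then show ?thesis using phase_Suc_cases[of c x n] Suc by auto
qed

lemma phase_eq_iff: "q n = j \<longleftrightarrow> entry j \<le> n \<and> n < entry (Suc j)"
  using entry_le_iff[of j n] entry_le_iff[of "Suc j" n] by auto

lemma entry_strict_mono: "entry j < entry (Suc j)"
  using phase_entry[of j] phase_eq_iff by blast

lemma entry_Suc_pred:
  obtains n where "entry (Suc j) = Suc n" "q n = j" "entry j \<le> n"
proof -
  obtain n where n: "entry (Suc j) = Suc n" using entry_strict_mono[of j] by (cases "entry (Suc j)") auto
  moreover have "q n = j" using n entry_strict_mono[of j] by (subst phase_eq_iff) auto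
  ultimately show thesis using that[of n] by (simp add: entry_le_iff)
qed

lemma phase_Suc_not_entry:
  assumes "entry (q (Suc n)) \<noteq> Suc n"
  shows "q n = q (Suc n)"
proof -
  have "entry (q (Suc n)) \<le> Suc n" by (simp add: entry_le_iff)
  then have "entry (q (Suc n)) \<le> n" using assms by simp
  then have "q (Suc n) \<le> q n" by (simp add: entry_le_iff)
  then show ?thesis using phase_Suc_cases[of c x n] by auto
qed

lemma enter_odd:
  assumes "even j" "entry (Suc j) = Suc n"
  shows "H n \<le> r (Suc n)" "0 < r (Suc n)" "run_min V (Suc n) = run_min V n"
proof -
  have q: "q n = j" using assms(2) entry_Suc_pred[of j] by auto
  have q': "q (Suc n) = Suc j" using phase_entry[of "Suc j"] assms(2) by simp
  show 1: "H n \<le> r (Suc n)"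
    using q q' assms(1) by (auto simp: phase_Suc elevation_Suc split: if_splits)
  then show "0 < r (Suc n)" using barrier_ge[of n] c_pos by simp
  then show "run_min V (Suc n) = run_min V n"
    using run_min_walk_Suc[of x n c] by (simp add: elevation_Suc)
qed

lemma enter_even:
  assumes "odd j" "entry (Suc j) = Suc n"
  shows "r (Suc n) = 0" "V (Suc n) \<le> run_min V n" "H (Suc n) = H n"
proof -
  have q: "q n = j" using assms(2) entry_Suc_pred[of j] by auto
  have q': "q (Suc n) = Suc j" using phase_entry[of "Suc j"] assms(2) by simp
  have z: "r n + x n \<le> 0"
    using q q' assms(1) by (auto simp: phase_Suc split: if_splits)
  then show "r (Suc n) = 0" by (simp add: elevation_Suc)
  show "V (Suc n) \<le> run_min V n" using z by (simp add: elevation_eq)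
  show "H (Suc n) = H n" using q' assms(1) by (simp add: barrier_Suc)
qed

lemma elevation_entry_even: "even j \<Longrightarrow> r (entry j) = 0"
proof (cases j)
  case (Suc i)
  assume "even j"
  moreover obtain n where "entry (Suc i) = Suc n" using entry_Suc_pred[of i] by blast
  ultimately show ?thesis using enter_even(1)[of i n] Suc by simp
qed simp

lemma barrier_even_const: "even (q n) \<Longrightarrow> H n = H (entry (q n))"
proof (induction n)
  case (Suc n)
  show ?case
  proof (cases "entry (q (Suc n)) = Suc n")
    case False
    then have "q n = q (Suc n)" by (rule phase_Suc_not_entry)
    then show ?thesis using Suc by (simp add: barrier_Suc)
  qed simp
qed simp

text \<open>At the start of an odd phase the elevation is at least the old barrier, so the old
  barrier drops out of the maximum; afterwards the walk stays above its minimum until the phase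
  ends.\<close>

lemma odd_phase:
  "odd (q n) \<Longrightarrow> run_min V n = run_min V (entry (q n)) \<and> 0 < r n
    \<and> H n = Max (r ` {entry (q n)..n})"
proof (induction n)
  case (Suc n)
  show ?case
  proof (cases "entry (q (Suc n)) = Suc n")
    case True
    obtain j where j: "q (Suc n) = Suc j" "even j" using Suc.prems by (cases "q (Suc n)") auto
    have "H n \<le> r (Suc n)" "0 < r (Suc n)"
      using enter_odd[of j n] True j by auto
    then show ?thesis using True Suc.prems by (simp add: barrier_Suc)
  next
    case False
    then have q: "q (Suc n) = q n" by (rule phase_Suc_not_entry[symmetric])
    have o: "odd (q n)" using Suc.prems q by simp
    have IH: "run_min V n = run_min V (entry (q n))" "0 < r n" "H n = Max (r ` {entry (q n)..n})"
      using Suc.IH o by auto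
    have z: "0 < r n + x n" using q o by (auto simp: phase_Suc split: if_splits)
    have le: "entry (q n) \<le> n" by (simp add: entry_le_iff)
    then have ins: "{entry (q n)..Suc n} = insert (Suc n) {entry (q n)..n}"
      by auto
    have "Max (r ` {entry (q n)..Suc n}) = max (r (Suc n)) (H n)"
      unfolding ins IH(3) image_insert using le by (intro Max_insert) auto
    moreover have "H (Suc n) = max (H n) (r (Suc n))"
      using q o by (simp add: barrier_Suc)
    moreover have "run_min V (Suc n) = run_min V n" "0 < r (Suc n)"
      using z by (simp_all add: run_min_walk_Suc[of x n c] elevation_Suc)
    ultimately show ?thesis using IH by (simp add: q max.commute)
  qed
qed simp

end

text \<open>The computable stand-in for the width: elevations are measured from the minimum up to
  \<open>n\<close>, which is the level of \<open>b_k\<close> once phase \<open>2*k+1\<close> has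
  begun, and summation starts with phase \<open>a\<close>, hence at a time that is known when it
  occurs.\<close>

definition well_weight :: "real \<Rightarrow> (nat \<Rightarrow> real) \<Rightarrow> nat \<Rightarrow> nat \<Rightarrow> real" where
  "well_weight c x a n = (\<Sum>i | i \<le> n \<and> a \<le> phase c x i. exp (- (walk_pos x i - run_min (walk_pos x) n)))"

text \<open>A drop of the minimum raises all earlier sites by the same amount relative to it, so the
  old sum is rescaled by one common factor.\<close>

lemma well_weight_Suc:
  "well_weight c x a (Suc n) = well_weight c x a n * exp (min 0 (elevation c x n + x n))
    + (if a \<le> phase c x (Suc n) then exp (- elevation c x (Suc n)) else 0)"
proof -
  let ?A = "\<lambda>n. {i. i \<le> n \<and> a \<le> phase c x i}" and ?V = "walk_pos x"
  have fin: "finite (?A n)" by simp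
  have "(\<Sum>i\<in>?A n. exp (- (?V i - run_min ?V (Suc n))))
      = well_weight c x a n * exp (min 0 (elevation c x n + x n))"
    unfolding well_weight_def sum_distrib_right
    by (intro sum.cong refl) (simp only: run_min_walk_Suc[of x n c], simp add: exp_add[symmetric] algebra_simps)
  moreover have "?A (Suc n) = (if a \<le> phase c x (Suc n) then insert (Suc n) (?A n) else ?A n)"
    by (auto simp: le_Suc_eq)
  ultimately show ?thesis
    using fin by (auto simp: well_weight_def elevation_eq[of c x "Suc n"] simp del: walk_pos_Suc)
qed

lemma well_weight_0: "well_weight c x 0 0 = 1"
  by (simp add: well_weight_def)

lemma well_weight_before: "phase c x n < a \<Longrightarrow> well_weight c x a n = 0"
proof -
  assume "phase c x n < a"
  then have "{i. i \<le> n \<and> a \<le> phase c x i} = {}" using phase_mono[of _ n c x] by fastforce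
  then show ?thesis unfolding well_weight_def by (simp only: sum.empty)
qed

section \<open>Valley times and levels in terms of phases\<close>

declare valley_eta.simps [simp del] valley_bottom.simps [simp del]
  valley_theta.simps [simp del] valley_H.simps [simp del]

context valley_path
begin

lemma Inf_eta: "Inf {i. i > entry (2*k) \<and> V i - Min (V ` {0..i}) \<ge> H (entry (2*k))} = entry (2*k+1)"
proof (rule cInf_eq_minimum)
  obtain n where n: "entry (2*k+1) = Suc n" "q n = 2*k" using entry_Suc_pred[of "2*k"] by auto
  have "H (entry (2*k)) \<le> r (entry (2*k+1))"
    using enter_odd(1)[of "2*k" n] barrier_even_const[of n] n by simp
  then show "entry (2*k+1) \<in> {i. i > entry (2*k) \<and> V i - Min (V ` {0..i}) \<ge> H (entry (2*k))}"
    using entry_strict_mono[of "2*k"] by (simp add: elevation_eq run_min_def)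
next
  fix i assume "i \<in> {i. i > entry (2*k) \<and> V i - Min (V ` {0..i}) \<ge> H (entry (2*k))}"
  then have i: "entry (2*k) < i" "H (entry (2*k)) \<le> r i" by (simp_all add: elevation_eq run_min_def)
  show "entry (2*k+1) \<le> i"
  proof (rule ccontr)
    assume "\<not> ?thesis"
    then have "q i = 2*k" using i by (subst phase_eq_iff) auto
    then show False
      using i elevation_le_barrier[OF c_pos, of x i] barrier_even_const[of i] by simp
  qed
qed

text \<open>The definition of \<open>b_k\<close> minimises from \<open>\<theta>_k\<close> on, the
  elevation from 0 on. Both minima agree because \<open>V\<close> is at its running minimum at
  \<open>\<theta>_k\<close>; the minimum is attained before \<open>\<eta>_k\<close> because the
  elevation there is positive.\<close>

lemma min_at_bottom:
  "\<exists>i. entry (2*k) \<le> i \<and> i < entry (2*k+1) \<and> V i = run_min V (entry (2*k+1))"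
proof -
  let ?e = "entry (2*k+1)"
  have "run_min V ?e \<in> V ` {0..?e}" unfolding run_min_def by (intro Min_in) auto
  then obtain i where i: "i \<le> ?e" "V i = run_min V ?e" by auto
  have s: "entry (2*k) < ?e" using entry_strict_mono[of "2*k"] by simp
  show ?thesis
  proof (cases "entry (2*k) \<le> i")
    case True
    have "0 < r ?e" using odd_phase[of ?e] phase_entry[of "2*k+1"] by simp
    then have "i \<noteq> ?e" using i by (auto simp: elevation_eq)
    then show ?thesis using True i by auto
  next
    case False
    then have "V (entry (2*k)) \<le> V i"
      using elevation_entry_even[of "2*k"] run_min_le[of i "entry (2*k)" V] by (simp add: elevation_eq)
    then show ?thesis using run_min_le[of "entry (2*k)" ?e V] s i by (intro exI[of _ "entry (2*k)"]) auto
  qed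
qed

lemma V_Sup_bottom:
  "V (Sup {i. i < entry (2*k+1) \<and> V i = Min (V ` {entry (2*k)..entry (2*k+1)})}) = run_min V (entry (2*k+1))"
proof -
  let ?e = "entry (2*k+1)"
  obtain i where i: "entry (2*k) \<le> i" "i < ?e" "V i = run_min V ?e" using min_at_bottom by blast
  have min: "Min (V ` {entry (2*k)..?e}) = run_min V ?e"
    by (rule Min_eqI) (use i run_min_le in \<open>auto simp: image_iff intro!: bexI[of _ i]\<close>)
  let ?A = "{i. i < ?e \<and> V i = run_min V ?e}"
  have "finite ?A" "?A \<noteq> {}" using i by auto
  then have "Sup ?A \<in> ?A" unfolding cSup_eq_Max[OF \<open>finite ?A\<close> \<open>?A \<noteq> {}\<close>] by (rule Max_in)
  then show ?thesis unfolding min by simp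
qed

lemma Inf_theta: "Inf {i. i > entry (2*k+1) \<and> V i \<le> run_min V (entry (2*k+1))} = entry (2*k+2)"
proof (rule cInf_eq_minimum)
  obtain n where n: "entry (2*k+2) = Suc n" "q n = 2*k+1" using entry_Suc_pred[of "2*k+1"] by auto
  have "V (Suc n) \<le> run_min V (entry (2*k+1))"
    using enter_even(2)[of "2*k+1" n] odd_phase[of n] n by simp
  then show "entry (2*k+2) \<in> {i. i > entry (2*k+1) \<and> V i \<le> run_min V (entry (2*k+1))}"
    using entry_strict_mono[of "2*k+1"] n by simp
next
  fix i assume i: "i \<in> {i. i > entry (2*k+1) \<and> V i \<le> run_min V (entry (2*k+1))}"
  show "entry (2*k+2) \<le> i"
  proof (rule ccontr)
    assume "\<not> ?thesis"
    then have "q i = 2*k+1" using i by (subst phase_eq_iff) auto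
    then show False using i odd_phase[of i] by (simp add: elevation_eq)
  qed
qed

text \<open>At \<open>\<theta>_{k+1}\<close> the path is back at or below the bottom, so the maximum
  is attained strictly earlier; this places \<open>m_{k+1}\<close> inside phase
  \<open>2*k+1\<close>.\<close>

lemma Max_crossing:
  "Max (V ` {entry (2*k+1)..entry (2*k+2)}) = H (entry (2*k+2)) + run_min V (entry (2*k+1))"
  "\<exists>i. entry (2*k+1) \<le> i \<and> i < entry (2*k+2) \<and> V i = H (entry (2*k+2)) + run_min V (entry (2*k+1))"
proof -
  let ?e = "entry (2*k+1)"
  obtain n where n: "entry (2*k+2) = Suc n" "q n = 2*k+1" "?e \<le> n" using entry_Suc_pred[of "2*k+1"] by auto
  have H: "H (Suc n) = Max (r ` {?e..n})"
    using enter_even(3)[of "2*k+1" n] odd_phase[of n] n by simp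
  have V: "V i = r i + run_min V ?e" if "?e \<le> i" "i \<le> n" for i
  proof -
    have "q i = 2*k+1" using that n by (subst phase_eq_iff) auto
    then show ?thesis using odd_phase[of i] by (simp add: elevation_eq)
  qed
  have "Max (r ` {?e..n}) \<in> r ` {?e..n}" using n by (intro Max_in) auto
  then obtain i where i: "?e \<le> i" "i \<le> n" "r i = H (Suc n)" unfolding H by auto
  show ex: "\<exists>i. ?e \<le> i \<and> i < entry (2*k+2) \<and> V i = H (entry (2*k+2)) + run_min V ?e"
    using i V[of i] n by (intro exI[of _ i]) auto
  show "Max (V ` {?e..entry (2*k+2)}) = H (entry (2*k+2)) + run_min V ?e"
  proof (rule Max_eqI)
    show "H (entry (2*k+2)) + run_min V ?e \<in> V ` {?e..entry (2*k+2)}" using ex by force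
    fix y assume "y \<in> V ` {?e..entry (2*k+2)}"
    then obtain j where j: "?e \<le> j" "j \<le> Suc n" "y = V j" using n by auto
    show "y \<le> H (entry (2*k+2)) + run_min V ?e"
    proof (cases "j = Suc n")
      case True
      have "V (Suc n) \<le> run_min V ?e"
        using enter_even(2)[of "2*k+1" n] odd_phase[of n] n by simp
      then show ?thesis using True j barrier_ge[of "entry (2*k+2)"] c_pos by simp
    next
      case False
      then have "r j \<le> H (Suc n)" unfolding H using j by (intro Max_ge) auto
      then show ?thesis using V[of j] j False n by simp
    qed
  qed simp
qed

text \<open>The four quantities are defined by mutual recursion, hence the joint induction. The
  bottom is identified by its level, which is what \<open>\<theta>\<close>, \<open>H\<close> and the
  width take from it.\<close>

lemma valley_times:
  "valley_eta c V k = entry (2*k+1) \<and> V (valley_bottom c V k) = run_min V (entry (2*k+1))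
   \<and> valley_theta c V (Suc k) = entry (2*k+2) \<and> valley_H c V k = H (entry (2*k+2))"
proof (induction k)
  case 0
  have e: "valley_eta c V 0 = entry 1" using Inf_eta[of 0] by (simp add: valley_eta.simps)
  have b: "V (valley_bottom c V 0) = run_min V (entry 1)"
    using V_Sup_bottom[of 0] e by (simp add: valley_bottom.simps)
  have t: "valley_theta c V (Suc 0) = entry 2"
    using Inf_theta[of 0] e b by (simp add: valley_theta.simps numeral_2_eq_2)
  have "valley_H c V 0 = H (entry 2)"
    using Max_crossing(1)[of 0] e b t by (simp add: valley_H.simps numeral_2_eq_2)
  with e b t show ?case by (simp add: numeral_2_eq_2)
next
  case (Suc k)
  then have th: "valley_theta c V (Suc k) = entry (2 * Suc k)" "valley_H c V k = H (entry (2 * Suc k))"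
    by simp_all
  have e: "valley_eta c V (Suc k) = entry (2 * Suc k + 1)"
    unfolding valley_eta.simps(2) th by (rule Inf_eta)
  have b: "V (valley_bottom c V (Suc k)) = run_min V (entry (2 * Suc k + 1))"
    unfolding valley_bottom.simps(2) th e by (rule V_Sup_bottom)
  have t: "valley_theta c V (Suc (Suc k)) = entry (2 * Suc k + 2)"
    unfolding valley_theta.simps(2)[of c V "Suc k"] e b by (rule Inf_theta)
  have "valley_H c V (Suc k) = H (entry (2 * Suc k + 2))"
    unfolding valley_H.simps e b t Max_crossing(1) by simp
  with e b t show ?case by simp
qed

lemma valley_begin_bounds: "entry (2*k+1) \<le> valley_begin c V (Suc k) \<and> valley_begin c V (Suc k) < entry (2*k+2)"
proof -
  let ?A = "{i. i \<ge> entry (2*k+1) \<and> V i = Max (V ` {entry (2*k+1)..entry (2*k+2)})}"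
  obtain i where i: "i \<in> ?A" "i < entry (2*k+2)" using Max_crossing[of k] by auto
  have "Inf ?A \<in> ?A" using i by (intro Inf_nat_def1) blast
  moreover have "Inf ?A \<le> i" using i by (intro cInf_lower) auto
  moreover have "valley_begin c V (Suc k) = Inf ?A"
    unfolding valley_begin_def using valley_times[of k] by simp
  ultimately show ?thesis using i by auto
qed

lemma well_weight_eq: "well_weight c x a n = (\<Sum>i=entry a..n. exp (- (V i - run_min V n)))"
proof -
  have "{i. i \<le> n \<and> a \<le> q i} = {entry a..n}" using entry_le_iff by auto
  then show ?thesis by (simp add: well_weight_def)
qed

text \<open>\<open>n\<close> is the last time before \<open>\<theta>_{k+1}\<close>: the running
  minimum is still the level of the bottom, and the index range of the width lies between
  \<open>\<eta>_{k-1}\<close> and \<open>n\<close>.\<close>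

lemma effective_width_le_weight:
  assumes k: "k \<ge> 1" and n: "2*k+2 = q (Suc n)" "q n = 2*k+1"
  shows "effective_width c V k \<le> well_weight c x (2*k-1) n"
proof -
  obtain j where j: "k = Suc j" using k by (cases k) auto
  have e: "entry (2*k+2) = Suc n"
    using entry_le_iff[of "2*k+2" "Suc n"] entry_le_iff[of "2*k+2" n] n by simp
  have m: "run_min V n = run_min V (entry (2*k+1))" using odd_phase[of n] n by simp
  have "effective_width c V k
      = (\<Sum>i\<in>{valley_begin c V k..<valley_begin c V (k+1)}. exp (- (V i - run_min V n)))"
    using valley_times[of k] m by (simp add: effective_width_def)
  also have "\<dots> \<le> (\<Sum>i\<in>{entry (2*k-1)..n}. exp (- (V i - run_min V n)))"
    using valley_begin_bounds[of j] valley_begin_bounds[of k] e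
    by (intro sum_mono2) (auto simp: j)
  finally show ?thesis by (simp add: well_weight_eq)
qed

text \<open>\<open>n\<close> is the last time before \<open>\<eta>_k\<close>: the step onto
  \<open>\<eta>_k\<close> sets no new minimum, so the level of the bottom is already known, and all
  of phase \<open>2*k\<close> up to \<open>n\<close> belongs to the valley.\<close>

lemma weight_le_effective_width:
  assumes k: "k \<ge> 1" and n: "q n = 2*k" "q (Suc n) = 2*k+1"
  shows "well_weight c x (2*k) n \<le> effective_width c V k"
proof -
  obtain j where j: "k = Suc j" using k by (cases k) auto
  have e: "entry (2*k+1) = Suc n"
    using entry_le_iff[of "2*k+1" "Suc n"] entry_le_iff[of "2*k+1" n] n by simp
  have m: "run_min V n = run_min V (entry (2*k+1))" using enter_odd(3)[of "2*k" n] e by simp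
  have "(\<Sum>i\<in>{entry (2*k)..n}. exp (- (V i - run_min V n)))
     \<le> (\<Sum>i\<in>{valley_begin c V k..<valley_begin c V (k+1)}. exp (- (V i - run_min V n)))"
    using valley_begin_bounds[of j] valley_begin_bounds[of k] e
    by (intro sum_mono2) (auto simp: j)
  also have "\<dots> = effective_width c V k"
    using valley_times[of k] m by (simp add: effective_width_def)
  finally show ?thesis by (simp add: well_weight_eq)
qed

end

section \<open>Exponential moments of the widths\<close>

text \<open>\<open>z\<close> is the elevation before reflection, hence \<open>z \<ge> - L\<close>. A
  new site costs the factor \<open>exp (a * exp (- z))\<close>. With h =
  \<open>exp (- z / 2)\<close> the site weight is h * h: one factor h keeps the prefactor, constant
  or linear in \<open>z\<close>, bounded, and the other makes the cost a small multiple of h.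
  Lowering the coefficient of h from 1 to \<open>\<kappa>\<close> pays for it, and
  \<open>\<kappa> * \<phi> \<ge> 1\<close> says that the drift of \<open>exp (- z / 2)\<close> makes
  up for the lowering. The last inequality treats reflection.\<close>

lemma upper_constants:
  fixes L \<phi> :: real
  assumes L: "L > 0" and \<phi>: "\<phi> > 1"
  obtains a A B \<kappa> :: real where
    "a > 0" "A \<ge> 1" "B \<ge> 0" "\<kappa> * \<phi> \<ge> 1"
    "\<And>z. - L \<le> z \<Longrightarrow> 1 \<le> A - exp (- z / 2)"
    "\<And>z. - L \<le> z \<Longrightarrow> 0 \<le> z + A - exp (- z / 2)"
    "\<And>z. - L \<le> z \<Longrightarrow> (A - exp (- z / 2)) * exp (a * exp (- z)) \<le> A - \<kappa> * exp (- z / 2)"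
    "\<And>z. - L \<le> z \<Longrightarrow> (z + A - exp (- z / 2)) * exp (a * exp (- z)) \<le> z + A - \<kappa> * exp (- z / 2)"
    "\<And>z w. - L \<le> z \<Longrightarrow> z \<le> 0 \<Longrightarrow> 0 \<le> w \<Longrightarrow>
       (A - 1) * exp (a * (w * exp z + 1)) \<le> B * (- z) + (z + A - \<kappa> * exp (- z / 2)) * exp (a * w)"
proof -
  \<comment> \<open>\<open>E\<close> bounds h, and \<open>K\<close> bounds the slope of the loss by
    reflection. The summand \<open>2 * L * K\<close> of \<open>A\<close> is for large
    \<open>w\<close> in \<open>neg\<close>. \<open>D\<close> bounds \<open>(z + A - h) * h\<close>,
    using \<open>z * h \<le> 2\<close>. The first entry of \<open>a\<close> gives
    \<open>a * exp (- z) \<le> 1\<close>, the second \<open>2 * a * D \<le> 1 - 1 / \<phi>\<close>.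
    In \<open>B\<close> the factor \<open>exp 1\<close> covers the site added at the new
    minimum.\<close>
  define E where "E = exp (L / 2)"
  define K where "K = 1 + E"
  define A where "A = 1 + E + 2 * L * K"
  define D where "D = 2 + A * E"
  define a where "a = min (exp (- L)) ((1 - 1 / \<phi>) / (2 * D))"
  define \<kappa> where "\<kappa> = 1 - 2 * a * D"
  define B where "B = exp 1 * (K * exp (exp L / L))"
  have E: "E \<ge> 1" using L by (simp add: E_def)
  have K: "K \<ge> 2" using E by (simp add: K_def)
  have LK: "2 * L \<le> 2 * L * K" using K L by simp
  have A: "A \<ge> 1 + E + 2 * L" "A \<ge> 1" using LK E L by (auto simp: A_def)
  have AE: "A * E \<ge> A" using A E by (simp add: mult_le_cancel_left1)
  have D: "D > 0" using A AE by (simp add: D_def add_pos_nonneg)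
  have a: "a > 0" using \<phi> D by (simp add: a_def)
  have aL: "a * exp L \<le> 1"
  proof -
    have "a * exp L \<le> exp (- L) * exp L" by (intro mult_right_mono) (auto simp: a_def)
    then show ?thesis by (simp add: exp_minus)
  qed
  have a1: "a \<le> 1"
    using aL L a by (smt (verit) mult_le_cancel_left1 one_le_exp_iff)
  have "a \<le> (1 - 1 / \<phi>) / (2 * D)" by (simp add: a_def)
  then have "2 * a * D \<le> 1 - 1 / \<phi>" using D by (simp add: field_simps)
  then have \<kappa>: "1 / \<phi> \<le> \<kappa>" by (simp add: \<kappa>_def)
  have \<kappa>': "\<kappa> * \<phi> \<ge> 1" using \<kappa> \<phi> by (simp add: field_simps)
  have half: "exp (- z / 2) \<le> E" if "- L \<le> z" for z using that by (simp add: E_def)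
  have sq: "exp (- z) = exp (- z / 2) * exp (- z / 2)" for z :: real
    by (simp add: exp_add[symmetric])
  have u1: "1 \<le> A - exp (- z / 2)" if "- L \<le> z" for z
    using half[OF that] A L by linarith
  have g0: "0 \<le> z + A - exp (- z / 2)" if "- L \<le> z" for z
    using half[OF that] A L that by linarith
  have ex: "exp (a * exp (- z)) \<le> 1 + 2 * a * exp (- z)" if "- L \<le> z" for z
  proof -
    let ?t = "a * exp (- z)"
    have "?t \<le> a * exp L" using that a by simp
    then have t1: "?t \<le> 1" using aL by (rule order_trans)
    have t: "0 \<le> ?t" using a by simp
    have "exp ?t \<le> 1 + ?t + ?t\<^sup>2" using t t1 by (rule exp_bound)
    also have "?t\<^sup>2 \<le> ?t" using t t1 by (simp add: power2_eq_square mult_left_le)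
    finally show ?thesis by simp
  qed
  have odd: "(A - exp (- z / 2)) * exp (a * exp (- z)) \<le> A - \<kappa> * exp (- z / 2)" if z: "- L \<le> z" for z
  proof -
    let ?h = "exp (- z / 2)"
    have "(A - ?h) * exp (a * exp (- z)) \<le> (A - ?h) * (1 + 2 * a * exp (- z))"
      using u1[OF z] ex[OF z] by (intro mult_left_mono) auto
    also have "\<dots> = A - ?h + 2 * a * ?h * ((A - ?h) * ?h)" by (simp add: sq[of z] algebra_simps)
    also have "\<dots> \<le> A - ?h + 2 * a * ?h * D"
    proof -
      have "(A - ?h) * ?h \<le> A * E" using u1[OF z] half[OF z] A by (intro mult_mono) auto
      then have "(A - ?h) * ?h \<le> D" by (simp add: D_def)
      then show ?thesis using a by simp
    qed
    finally show ?thesis by (simp add: \<kappa>_def algebra_simps)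
  qed
  have ze: "z * exp (- z / 2) \<le> 2" for z :: real
  proof -
    have "z / 2 \<le> exp (z / 2)" using exp_ge_add_one_self[of "z/2"] by linarith
    then have "z / 2 * exp (- z / 2) \<le> exp (z / 2) * exp (- z / 2)" by (rule mult_right_mono) simp
    also have "\<dots> = 1" by (simp add: exp_add[symmetric])
    finally show ?thesis by simp
  qed
  have even: "(z + A - exp (- z / 2)) * exp (a * exp (- z)) \<le> z + A - \<kappa> * exp (- z / 2)" if z: "- L \<le> z" for z
  proof -
    let ?h = "exp (- z / 2)"
    have "(z + A - ?h) * exp (a * exp (- z)) \<le> (z + A - ?h) * (1 + 2 * a * exp (- z))"
      using g0[OF z] ex[OF z] by (intro mult_left_mono) auto
    also have "\<dots> = z + A - ?h + 2 * a * ?h * (z * ?h + (A - ?h) * ?h)" by (simp add: sq[of z] algebra_simps)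
    also have "\<dots> \<le> z + A - ?h + 2 * a * ?h * D"
    proof -
      have "(A - ?h) * ?h \<le> A * E" using u1[OF z] half[OF z] A by (intro mult_mono) auto
      then have "z * ?h + (A - ?h) * ?h \<le> D" using ze[of z] by (simp add: D_def)
      then show ?thesis using a by simp
    qed
    finally show ?thesis by (simp add: \<kappa>_def algebra_simps)
  qed
  \<comment> \<open>At a new minimum the width \<open>w\<close> contracts by the factor \<open>exp z\<close>; for large \<open>w\<close> this gain outweighs
    the loss from reflecting \<open>z\<close> to \<open>0\<close>, and for small \<open>w\<close> that loss is at most a multiple of \<open>- z\<close>.\<close>
  have neg: "(A - 1) * exp (a * (w * exp z + 1)) \<le> B * (- z) + (z + A - \<kappa> * exp (- z / 2)) * exp (a * w)"
    if z: "- L \<le> z" "z \<le> 0" and w: "0 \<le> w" for z w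
  proof -
    define s where "s = - z"
    have s: "0 \<le> s" "s \<le> L" "z = - s" using z by (auto simp: s_def)
    let ?g = "z + A - exp (- z / 2)"
    let ?B = "K * exp (exp L / L)"
    have drop: "A - 1 \<le> ?g + K * s"
    proof -
      have "(1 - s / 2) \<le> exp (- (s / 2))" using exp_ge_add_one_self[of "- (s/2)"] by simp
      then have "(1 - s / 2) * exp (s / 2) \<le> exp (- (s / 2)) * exp (s / 2)" by (rule mult_right_mono) simp
      also have "\<dots> = 1" by (simp add: exp_add[symmetric])
      finally have "exp (s / 2) \<le> 1 + s / 2 * exp (s / 2)" by (simp add: algebra_simps)
      also have "s / 2 * exp (s / 2) \<le> s * E"
        using s by (intro mult_mono) (auto simp: E_def)
      finally show ?thesis using s by (simp add: K_def algebra_simps)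
    qed
    \<comment> \<open>Below the threshold \<open>exp L / L\<close> the factor
      \<open>exp (a * w)\<close> is bounded. Beyond it the contraction lowers the exponent by at
      least \<open>s / L\<close>, since \<open>1 - exp z \<ge> s * exp (- L)\<close>; the gain is
      then at least \<open>K * s\<close> by the choice of \<open>A\<close>.\<close>
    have main: "(A - 1) * exp (a * (w * exp z)) \<le> ?B * s + ?g * exp (a * w)"
    proof (cases "exp L / L \<le> a * w")
      case False
      have "(A - 1) * exp (a * (w * exp z)) \<le> (A - 1) * exp (a * w)"
        using A w a z by (intro mult_left_mono) (auto intro!: mult_left_le)
      also have "\<dots> \<le> (?g + K * s) * exp (a * w)"
        using drop by (rule mult_right_mono) simp
      also have "\<dots> = K * s * exp (a * w) + ?g * exp (a * w)" by (simp add: algebra_simps)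
      also have "K * s * exp (a * w) \<le> K * s * exp (exp L / L)"
        using False K s by (intro mult_left_mono) auto
      finally show ?thesis by (simp add: algebra_simps)
    next
      case True
      define t where "t = s / L"
      have t: "0 \<le> t" "t \<le> 1" using s L by (auto simp: t_def)
      have "s * exp (- L) \<le> s * exp (- s)" using s by (intro mult_left_mono) auto
      also have "\<dots> \<le> 1 - exp (- s)"
      proof -
        have "(1 + s) * exp (- s) \<le> exp s * exp (- s)"
          by (intro mult_right_mono) (auto simp: exp_ge_add_one_self)
        also have "\<dots> = 1" by (simp add: exp_add[symmetric])
        finally show ?thesis by (simp add: algebra_simps)
      qed
      finally have 1: "s * exp (- L) \<le> 1 - exp z" using s by simp
      have "t = exp L / L * (s * exp (- L))" by (simp add: t_def exp_minus field_simps)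
      also have "\<dots> \<le> a * w * (1 - exp z)"
        using True 1 s L a w by (intro mult_mono) auto
      finally have "exp (a * (w * exp z)) \<le> exp (a * w - t)" by (simp add: algebra_simps)
      also have "\<dots> = exp (a * w) * exp (- t)" by (simp add: exp_add[symmetric])
      also have "exp (- t) \<le> 1 - t / 2"
      proof -
        have "exp (- t) = 1 / exp t" by (simp add: exp_minus field_simps)
        also have "\<dots> \<le> 1 / (1 + t)" using t by (intro divide_left_mono) (auto simp: exp_ge_add_one_self add_pos_nonneg)
        also have "\<dots> \<le> 1 - t / 2"
        proof -
          have "t * t \<le> t" using t by (simp add: mult_left_le)
          then show ?thesis using t by (simp add: field_simps)
        qed
        finally show ?thesis .
      qed
      finally have "exp (a * (w * exp z)) \<le> exp (a * w) * (1 - t / 2)" by simp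
      then have "(A - 1) * exp (a * (w * exp z)) \<le> (A - 1) * (exp (a * w) * (1 - t / 2))"
        using A by (intro mult_left_mono) auto
      also have "\<dots> = (A - 1 - (A - 1) * (t / 2)) * exp (a * w)" by (simp add: algebra_simps)
      also have "\<dots> \<le> ?g * exp (a * w)"
      proof (rule mult_right_mono)
        have "2 * L * K * (t / 2) \<le> (A - 1) * (t / 2)"
          using t E by (intro mult_right_mono) (auto simp: A_def)
        moreover have "2 * L * K * (t / 2) = K * s" using L by (simp add: t_def)
        ultimately show "A - 1 - (A - 1) * (t / 2) \<le> ?g" using drop by linarith
      qed simp
      also have "\<dots> \<le> ?B * s + ?g * exp (a * w)" using K s by simp
      finally show ?thesis .
    qed
    have "(A - 1) * exp (a * (w * exp z + 1)) = (A - 1) * exp (a * (w * exp z)) * exp a"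
      by (simp add: exp_add[symmetric] algebra_simps)
    also have "\<dots> \<le> (?B * s + ?g * exp (a * w)) * exp a"
      using main by (rule mult_right_mono) simp
    also have "\<dots> = ?B * s * exp a + ?g * exp a * exp (a * w)" by (simp add: algebra_simps)
    also have "\<dots> \<le> B * s + (z + A - \<kappa> * exp (- z / 2)) * exp (a * w)"
    proof (rule add_mono)
      have "?B * s * exp a \<le> ?B * s * exp 1" using K s a1 by (intro mult_left_mono) auto
      then show "?B * s * exp a \<le> B * s" by (simp add: B_def algebra_simps)
      have "?g * exp a \<le> ?g * exp (a * exp (- z))"
        using g0[OF z(1)] a z by (intro mult_left_mono) (auto simp: mult_le_cancel_left1)
      also have "\<dots> \<le> z + A - \<kappa> * exp (- z / 2)" using even[OF z(1)] .
      finally show "?g * exp a * exp (a * w) \<le> (z + A - \<kappa> * exp (- z / 2)) * exp (a * w)"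
        by (rule mult_right_mono) simp
    qed
    finally show ?thesis by (simp add: s_def)
  qed
  have B: "B \<ge> 0" using K by (simp add: B_def)
  show thesis
    by (rule that[of a A B \<kappa>]) (use a A B \<kappa>' u1 g0 odd even neg in blast)+
qed

text \<open>
  The second component of the state is the weight \<open>well_weight\<close> accumulated since \<open>\<eta>\<^sub>k\<^sub>-\<^sub>1\<close>; it is
  frozen at \<open>\<theta>\<^sub>k\<^sub>+\<^sub>1\<close>.
\<close>

definition upper_step :: "nat \<Rightarrow> (nat \<times> real \<times> real) \<times> real \<Rightarrow> real \<Rightarrow> (nat \<times> real \<times> real) \<times> real" where
  "upper_step k s y = (core_step (fst s) y,
     if 2*k+2 \<le> next_phase (fst s) y then snd s
     else if 2*k-1 \<le> next_phase (fst s) y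
       then snd s * exp (min 0 (fst (snd (fst s)) + y)) + exp (- max 0 (fst (snd (fst s)) + y))
     else 0)"

lemma fst_upper_step: "fst (upper_step k s y) = core_step (fst s) y"
  by (simp add: upper_step_def)

lemma upper_run_core: "fst (run (upper_step k) ((0, 0, c), 0) x n) = core c x n"
  by (induction n) (simp_all add: core_def fst_upper_step)

lemma next_phase_core: "next_phase (core c x n) (x n) = phase c x (Suc n)"
  by (simp add: phase_Suc next_phase_def core_eq)

lemma upper_run_Suc:
  "snd (run (upper_step k) ((0, 0, c), 0) x (Suc n)) =
     (if 2*k+2 \<le> phase c x (Suc n) then snd (run (upper_step k) ((0, 0, c), 0) x n)
      else if 2*k-1 \<le> phase c x (Suc n)
        then snd (run (upper_step k) ((0, 0, c), 0) x n) * exp (min 0 (elevation c x n + x n))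
          + exp (- elevation c x (Suc n))
      else 0)"
  unfolding run.simps upper_step_def[of k "run (upper_step k) ((0, 0, c), 0) x n"]
    upper_run_core next_phase_core elevation_Suc by (simp add: core_eq)

lemma upper_run_weight:
  assumes k: "k \<ge> 1"
  shows "phase c x n \<le> 2*k+1 \<Longrightarrow> snd (run (upper_step k) ((0, 0, c), 0) x n) = well_weight c x (2*k-1) n"
proof (induction n)
  case 0
  then show ?case using k by (simp add: well_weight_before)
next
  case (Suc n)
  have le: "phase c x n \<le> 2*k+1" using Suc.prems phase_mono[of n "Suc n" c x] by simp
  show ?case
  proof (cases "2*k-1 \<le> phase c x (Suc n)")
    case True
    then show ?thesis using Suc.prems Suc.IH[OF le]
      unfolding upper_run_Suc well_weight_Suc by simp
  next
    case False
    then show ?thesis using Suc.prems unfolding upper_run_Suc by (simp add: well_weight_before)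
  qed
qed

lemma (in valley_path) effective_width_le_upper_run:
  assumes k: "k \<ge> 1"
  shows "2*k+2 \<le> q n \<Longrightarrow> effective_width c V k \<le> snd (run (upper_step k) ((0, 0, c), 0) x n)"
proof (induction n)
  case (Suc n)
  have w: "snd (run (upper_step k) ((0, 0, c), 0) x (Suc n)) = snd (run (upper_step k) ((0, 0, c), 0) x n)"
    using Suc.prems unfolding upper_run_Suc by simp
  show ?case
  proof (cases "2*k+2 \<le> q n")
    case True
    then show ?thesis unfolding w by (rule Suc.IH)
  next
    case False
    then have "q n = 2*k+1" "2*k+2 = q (Suc n)" using phase_Suc_cases[of c x n] Suc.prems by auto
    then show ?thesis
      unfolding w using effective_width_le_weight[OF k, of n] upper_run_weight[OF k, of c x n] by simp
  qed
qed simp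

abbreviation core_space :: "(nat \<times> real \<times> real) measure" where
  "core_space \<equiv> count_space UNIV \<Otimes>\<^sub>M borel \<Otimes>\<^sub>M borel"

lemma next_phase_measurable:
  "(\<lambda>p. next_phase (fst p) (snd p)) \<in> core_space \<Otimes>\<^sub>M borel \<rightarrow>\<^sub>M count_space UNIV"
  unfolding next_phase_def by measurable

lemma core_step_measurable:
  "(\<lambda>p. core_step (fst p) (snd p)) \<in> core_space \<Otimes>\<^sub>M borel \<rightarrow>\<^sub>M core_space"
  unfolding core_step_def next_phase_def by measurable

lemma upper_step_measurable:
  "(\<lambda>(s, y). upper_step k s y) \<in> (core_space \<Otimes>\<^sub>M borel) \<Otimes>\<^sub>M borel \<rightarrow>\<^sub>M (core_space \<Otimes>\<^sub>M borel)"
proof -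
  let ?P = "(core_space \<Otimes>\<^sub>M borel) \<Otimes>\<^sub>M borel :: (((nat \<times> real \<times> real) \<times> real) \<times> real) measure"
  have pr: "(\<lambda>p. (fst (fst p), snd p)) \<in> ?P \<rightarrow>\<^sub>M core_space \<Otimes>\<^sub>M borel" by measurable
  have [measurable]: "(\<lambda>p. next_phase (fst (fst p)) (snd p)) \<in> ?P \<rightarrow>\<^sub>M count_space UNIV"
      "(\<lambda>p. core_step (fst (fst p)) (snd p)) \<in> ?P \<rightarrow>\<^sub>M core_space"
    using measurable_compose[OF pr next_phase_measurable] measurable_compose[OF pr core_step_measurable]
    by simp_all
  show ?thesis unfolding upper_step_def split_def by measurable
qed

definition core_inv :: "real \<Rightarrow> nat \<times> real \<times> real \<Rightarrow> bool" where
  "core_inv c s \<longleftrightarrow> 0 \<le> fst (snd s) \<and> c \<le> snd (snd s) \<and> (even (fst s) \<longrightarrow> fst (snd s) < snd (snd s))"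

lemma core_inv_step: "0 < c \<Longrightarrow> core_inv c s \<Longrightarrow> core_inv c (core_step s y)"
  by (auto simp: core_inv_def core_step_def next_phase_def)

section \<open>A supermartingale for the exponential moment of a width\<close>

context walk
begin

lemma exp_drift:
  assumes "\<kappa> * (\<integral>y. exp (- y / 2) \<partial>\<mu>) \<ge> 1"
  shows "integrable \<mu> (\<lambda>y. \<kappa> * exp (- (r + y) / 2))"
    and "exp (- r / 2) \<le> (\<integral>y. \<kappa> * exp (- (r + y) / 2) \<partial>\<mu>)"
proof -
  have eq: "\<kappa> * exp (- (r + y) / 2) = \<kappa> * exp (- r / 2) * exp (- y / 2)" for y
    by (simp add: exp_add[symmetric] add_divide_distrib)
  have int: "integrable \<mu> (\<lambda>y. exp (- y / 2))"
    by (rule bounded_integrable[where B="exp (L / 2)"]) (auto simp: abs_le_iff)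
  show "integrable \<mu> (\<lambda>y. \<kappa> * exp (- (r + y) / 2))" unfolding eq using int by simp
  have "1 * exp (- r / 2) \<le> \<kappa> * (\<integral>y. exp (- y / 2) \<partial>\<mu>) * exp (- r / 2)"
    using assms by (rule mult_right_mono) simp
  also have "\<dots> = (\<integral>y. \<kappa> * exp (- (r + y) / 2) \<partial>\<mu>)"
    unfolding eq using int by (simp add: algebra_simps)
  finally show "exp (- r / 2) \<le> (\<integral>y. \<kappa> * exp (- (r + y) / 2) \<partial>\<mu>)" by simp
qed

text \<open>The constants are fixed before \<open>k\<close> and do not depend on the barrier met in
  phase \<open>2*k\<close>, of which only \<open>H \<ge> c\<close> is used; this uniformity makes
  the tails summable at logarithmic levels.\<close>

lemma upper_tail:
  assumes c: "c > 0"
  obtains a C where "a > 0" "C \<ge> 0"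
    "\<And>k b. k \<ge> 1 \<Longrightarrow> measure S {x \<in> space S. \<exists>n. 2*k+2 \<le> fst (fst (run (upper_step k) ((0, 0, c), 0) x n))
        \<and> b \<le> snd (run (upper_step k) ((0, 0, c), 0) x n)} \<le> C * exp (- a * b)"
proof -
  obtain a A B \<kappa> where a: "a > 0" and A: "A \<ge> 1" and B: "B \<ge> 0"
    and \<kappa>: "\<kappa> * (\<integral>y. exp (- y / 2) \<partial>\<mu>) \<ge> 1"
    and u1: "\<And>z. - L \<le> z \<Longrightarrow> 1 \<le> A - exp (- z / 2)"
    and g0: "\<And>z. - L \<le> z \<Longrightarrow> 0 \<le> z + A - exp (- z / 2)"
    and odd: "\<And>z. - L \<le> z \<Longrightarrow> (A - exp (- z / 2)) * exp (a * exp (- z)) \<le> A - \<kappa> * exp (- z / 2)"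
    and even: "\<And>z. - L \<le> z \<Longrightarrow> (z + A - exp (- z / 2)) * exp (a * exp (- z)) \<le> z + A - \<kappa> * exp (- z / 2)"
    and neg: "\<And>z w. - L \<le> z \<Longrightarrow> z \<le> 0 \<Longrightarrow> 0 \<le> w \<Longrightarrow>
       (A - 1) * exp (a * (w * exp z + 1)) \<le> B * (- z) + (z + A - \<kappa> * exp (- z / 2)) * exp (a * w)"
    by (rule upper_constants[OF L_pos exp_step_mean_gt_1], (rule that; assumption))
  \<comment> \<open>\<open>u\<close> and \<open>g\<close> are the constant and the linear function with the concave correction \<open>- exp (- r / 2)\<close>.
    In phase \<open>2 k\<close> division by \<open>H\<close> matches \<open>g r \<ge> H\<close> on leaving the phase.\<close>
  define u where "u r = A - exp (- r / 2)" for r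
  define g where "g r = r + A - exp (- r / 2)" for r
  \<comment> \<open>On entering phase \<open>2*k\<close> the elevation is 0 and
    \<open>g 0 = A - 1\<close>. \<open>C1\<close> and \<open>C2\<close> are the two coefficients of
    the potential of that phase at this point, with \<open>H\<close> replaced by its lower bound
    \<open>c\<close>.\<close>
  define C1 where "C1 = A * B * (1 + L / c)"
  define C2 where "C2 = A * (A - 1) / c"
  have C: "C1 \<ge> 0" "C2 \<ge> 0" using A B L_pos c by (simp_all add: C1_def C2_def)
  have kodd_ge: "exp (a * exp (- z)) \<le> A - \<kappa> * exp (- z / 2)" if "- L \<le> z" for z
  proof -
    have "1 * exp (a * exp (- z)) \<le> (A - exp (- z / 2)) * exp (a * exp (- z))"
      using u1[OF that] by (rule mult_right_mono) simp
    then show ?thesis using odd[OF that] by linarith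
  qed
  have bound: "measure S {x \<in> space S. \<exists>n. 2*k+2 \<le> fst (fst (run (upper_step k) ((0, 0, c), 0) x n))
        \<and> b \<le> snd (run (upper_step k) ((0, 0, c), 0) x n)} \<le> (C1 + C2 * A * exp a) / exp (a * b)"
    if k: "k \<ge> 1" for k b
  proof -
    let ?R = "core_space \<Otimes>\<^sub>M borel :: ((nat \<times> real \<times> real) \<times> real) measure"
    \<comment> \<open>In phase \<open>2*k\<close> the linear term \<open>B * (H + L - r)\<close>
      pays for reflection: continued linearly to a negative elevation z it would be larger by
      \<open>B * (- z)\<close>, exactly the allowance in \<open>neg\<close>. The \<open>L\<close>
      keeps it nonnegative after an overshoot of \<open>H\<close>. The remaining cases are chosen so
      that no transition to the next phase increases the mean.\<close>
    define \<Phi> :: "(nat \<times> real \<times> real) \<times> real \<Rightarrow> real" where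
      "\<Phi> s = (if 2*k+2 \<le> fst (fst s) then exp (a * snd s)
         else if fst (fst s) = 2*k+1 then u (fst (snd (fst s))) * exp (a * snd s)
         else if fst (fst s) = 2*k then A * (B * (snd (snd (fst s)) + L - fst (snd (fst s)))
            + g (fst (snd (fst s))) * exp (a * snd s)) / snd (snd (fst s))
         else if fst (fst s) = 2*k-1 then C1 + C2 * (u (fst (snd (fst s))) * exp (a * snd s))
         else C1 + C2 * A * exp a)" for s
    define Inv where "Inv s \<longleftrightarrow> core_inv c (fst s) \<and> 0 \<le> snd s \<and> (fst (fst s) < 2*k-1 \<longrightarrow> snd s = 0)"
      for s :: "(nat \<times> real \<times> real) \<times> real"
    define T where "T s \<longleftrightarrow> 2*k+2 \<le> fst (fst s) \<and> b \<le> snd s" for s :: "(nat \<times> real \<times> real) \<times> real"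
    have \<Phi>: "\<Phi> \<in> borel_measurable ?R"
      unfolding \<Phi>_def u_def g_def by measurable
    have T: "Measurable.pred ?R T" unfolding T_def by measurable
    have Inv_step: "Inv (upper_step k s y)" if "Inv s" for s y
      using that c by (auto simp: Inv_def fst_upper_step core_inv_step)
        (auto simp: upper_step_def core_step_def)
    have \<Phi>_nonneg: "0 \<le> \<Phi> s" if I: "Inv s" for s
    proof -
      obtain q r H w where s: "s = ((q, r, H), w)" by (metis prod_cases3 surj_pair)
      have r: "0 \<le> r" "c \<le> H" "even q \<Longrightarrow> r < H" "0 \<le> w" using I by (auto simp: s Inv_def core_inv_def)
      have "0 \<le> u r" "0 \<le> g r" using u1[of r] g0[of r] r L_pos by (simp_all add: u_def g_def)
      moreover have "0 \<le> H + L - r" if "q = 2*k" using r L_pos that by simp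
      ultimately show ?thesis using r c A B C by (auto simp: s \<Phi>_def)
    qed
    have step: "(\<integral>\<^sup>+y. ennreal (\<Phi> (upper_step k s y)) \<partial>\<mu>) \<le> ennreal (\<Phi> s)" if I: "Inv s" for s
    proof -
      obtain q r H w where s: "s = ((q, r, H), w)" by (metis prod_cases3 surj_pair)
      have r: "0 \<le> r" "c \<le> H" "even q \<Longrightarrow> r < H" "0 \<le> w" "q < 2*k-1 \<Longrightarrow> w = 0"
        using I by (auto simp: s Inv_def core_inv_def)
      have H: "H > 0" using r c by simp
      define ew where "ew = exp (a * w)"
      have ew: "ew > 0" by (simp add: ew_def)
      have ew_add: "exp (a * (w + t)) = exp (a * t) * ew" for t
        by (simp add: ew_def exp_add[symmetric] distrib_left)
      define ko where "ko y = (A - \<kappa> * exp (- (r + y) / 2)) * ew" for y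
      have ko: "integrable \<mu> ko" "(\<integral>y. ko y \<partial>\<mu>) \<le> u r * ew"
        unfolding ko_def using exp_drift[OF \<kappa>, of r] ew
        by (auto simp: u_def intro!: Bochner_Integration.integrable_diff)
      define ke where "ke y = A * (B * (H + L - (r + y)) + ((r + y) + A - \<kappa> * exp (- (r + y) / 2)) * ew) / H" for y
      have ke_eq: "ke y = A * B * (H + L - r) / H + A * (r + A) / H * ew + (A * ew - A * B) / H * y
          - A / H * ew * (\<kappa> * exp (- (r + y) / 2))" for y
        using H by (simp add: ke_def field_simps)
      have ke: "integrable \<mu> ke" "(\<integral>y. ke y \<partial>\<mu>) \<le> A * (B * (H + L - r) + g r * ew) / H"
      proof -
        show "integrable \<mu> ke" unfolding ke_eq using exp_drift(1)[OF \<kappa>, of r] by simp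
        have "(\<integral>y. ke y \<partial>\<mu>) = A * B * (H + L - r) / H + A * (r + A) / H * ew
            - A / H * ew * (\<integral>y. \<kappa> * exp (- (r + y) / 2) \<partial>\<mu>)"
          unfolding ke_eq using exp_drift(1)[OF \<kappa>, of r] by (simp add: step_mean)
        also have "\<dots> \<le> A * B * (H + L - r) / H + A * (r + A) / H * ew - A / H * ew * exp (- r / 2)"
          using exp_drift(2)[OF \<kappa>, of r] A H ew by (intro diff_left_mono mult_left_mono) auto
        also have "\<dots> = A * (B * (H + L - r) + g r * ew) / H"
          using H by (simp add: g_def field_simps)
        finally show "(\<integral>y. ke y \<partial>\<mu>) \<le> A * (B * (H + L - r) + g r * ew) / H" .
      qed
      have nn: "0 \<le> \<Phi> (upper_step k s y)" for y using I Inv_step \<Phi>_nonneg by blast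
      have z: "- L \<le> r + y" if "\<bar>y\<bar> \<le> L" for y using that r by auto
      have ko_u: "u (r + y) * exp (a * (w + exp (- (r + y)))) \<le> ko y" if "\<bar>y\<bar> \<le> L" for y
      proof -
        have "u (r + y) * exp (a * exp (- (r + y))) * ew \<le> ko y"
          unfolding ko_def u_def using odd[OF z[OF that]] ew by (intro mult_right_mono) auto
        then show ?thesis unfolding ew_add by (simp add: mult.assoc)
      qed
      have ko_1: "exp (a * exp (- (r + y))) * ew \<le> ko y" if "\<bar>y\<bar> \<le> L" for y
        unfolding ko_def using kodd_ge[OF z[OF that]] ew by (intro mult_right_mono) auto
      consider "2*k+2 \<le> q" | "q = 2*k+1" | "q = 2*k" | "q = 2*k-1" | "q < 2*k-1" by linarith
      then show ?thesis
      proof cases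
        case 1
        then have "\<Phi> (upper_step k s y) = \<Phi> s" for y
          by (auto simp: s \<Phi>_def upper_step_def core_step_def next_phase_def)
        then show ?thesis by (simp add: emeasure_eq_measure)
      next
        case 2
        show ?thesis
        proof (rule nn_integral_le_bound[OF ko(1)])
          show "(\<integral>y. ko y \<partial>\<mu>) \<le> \<Phi> s" using ko(2) 2 by (simp add: s \<Phi>_def ew_def)
          fix y assume y: "\<bar>y\<bar> \<le> L"
          have "\<Phi> (upper_step k s y) \<le> ko y"
          proof (cases "r + y \<le> 0")
            case True
            then have "\<Phi> (upper_step k s y) = ew"
              using 2 by (simp add: s \<Phi>_def upper_step_def core_step_def next_phase_def ew_def)
            moreover have "1 * ew \<le> exp (a * exp (- (r + y))) * ew"
              using a ew by (intro mult_right_mono) auto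
            ultimately show ?thesis using ko_1[OF y] by linarith
          next
            case False
            then have "\<Phi> (upper_step k s y) = u (r + y) * exp (a * (w + exp (- (r + y))))"
              using 2 by (simp add: s \<Phi>_def upper_step_def core_step_def next_phase_def)
            then show ?thesis using ko_u[OF y] by simp
          qed
          then show "0 \<le> \<Phi> (upper_step k s y) \<and> \<Phi> (upper_step k s y) \<le> ko y" using nn by simp
        qed
      next
        case 3
        show ?thesis
        proof (rule nn_integral_le_bound[OF ke(1)])
          show "(\<integral>y. ke y \<partial>\<mu>) \<le> \<Phi> s" using ke(2) 3 by (simp add: s \<Phi>_def ew_def)
          fix y assume y: "\<bar>y\<bar> \<le> L"
          let ?z = "r + y"
          have rH: "r < H" using r 3 by simp
          have ge: "g ?z * exp (a * (w + exp (- ?z))) \<le> (?z + A - \<kappa> * exp (- ?z / 2)) * ew"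
          proof -
            have "g ?z * exp (a * exp (- ?z)) * ew \<le> (?z + A - \<kappa> * exp (- ?z / 2)) * ew"
              unfolding g_def using even[OF z[OF y]] ew by (intro mult_right_mono) auto
            then show ?thesis unfolding ew_add by (simp add: mult.assoc)
          qed
          have BH: "0 \<le> B * (H + L - ?z)" using B rH y by (intro mult_nonneg_nonneg) auto
          consider "?z \<le> 0" | "0 < ?z" "?z < H" | "H \<le> ?z" by linarith
          then have "\<Phi> (upper_step k s y) \<le> ke y"
          proof cases
            case z0: 1
            have "\<Phi> (upper_step k s y) = A * (B * (H + L) + (A - 1) * exp (a * (w * exp ?z + 1))) / H"
              using 3 z0 H k by (simp add: s \<Phi>_def upper_step_def core_step_def next_phase_def g_def)
            also have "\<dots> \<le> ke y"
              unfolding ke_def using neg[OF z[OF y] z0 r(4)] A H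
              by (intro divide_right_mono mult_left_mono) (auto simp: ew_def algebra_simps)
            finally show ?thesis .
          next
            case z1: 2
            have "\<Phi> (upper_step k s y) = A * (B * (H + L - ?z) + g ?z * exp (a * (w + exp (- ?z)))) / H"
              using 3 z1 H k by (simp add: s \<Phi>_def upper_step_def core_step_def next_phase_def)
            also have "\<dots> \<le> ke y"
              unfolding ke_def using ge A H by (intro divide_right_mono mult_left_mono add_left_mono) auto
            finally show ?thesis .
          next
            case z2: 3
            have "\<Phi> (upper_step k s y) = u ?z * exp (a * (w + exp (- ?z)))"
              using 3 z2 H k by (simp add: s \<Phi>_def upper_step_def core_step_def next_phase_def)
            also have "\<dots> \<le> A * exp (a * (w + exp (- ?z)))"
              by (intro mult_right_mono) (auto simp: u_def)
            also have "\<dots> = A * (H * exp (a * (w + exp (- ?z)))) / H" using H by simp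
            also have "\<dots> \<le> A * (g ?z * exp (a * (w + exp (- ?z)))) / H"
            proof (intro divide_right_mono mult_left_mono mult_right_mono)
              have "exp (- ?z / 2) \<le> 1" using z2 H by simp
              then show "H \<le> g ?z" using z2 A unfolding g_def by linarith
            qed (use A H in auto)
            also have "\<dots> \<le> ke y"
              unfolding ke_def using ge BH A H by (intro divide_right_mono mult_left_mono) auto
            finally show ?thesis .
          qed
          then show "0 \<le> \<Phi> (upper_step k s y) \<and> \<Phi> (upper_step k s y) \<le> ke y" using nn by simp
        qed
      next
        case 4
        have od: "odd (2*k-1)" "2*k-1 < 2*k" "Suc (2*k-1) = 2*k" using k by auto
        show ?thesis
        proof (rule nn_integral_le_bound[where k="\<lambda>y. C1 + C2 * ko y"])
          show "integrable \<mu> (\<lambda>y. C1 + C2 * ko y)" using ko(1) by simp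
          have "(\<integral>y. C1 + C2 * ko y \<partial>\<mu>) \<le> C1 + C2 * (u r * ew)"
            using ko C by (auto intro: mult_left_mono)
          then show "(\<integral>y. C1 + C2 * ko y \<partial>\<mu>) \<le> \<Phi> s" using 4 od by (simp add: s \<Phi>_def ew_def)
          fix y assume y: "\<bar>y\<bar> \<le> L"
          let ?z = "r + y"
          have "\<Phi> (upper_step k s y) \<le> C1 + C2 * ko y"
          proof (cases "?z \<le> 0")
            case True
            have "\<Phi> (upper_step k s y) = A * (B * (H + L) + (A - 1) * exp (a * (w * exp ?z + 1))) / H"
              using 4 True od by (simp add: s \<Phi>_def upper_step_def core_step_def next_phase_def g_def)
            also have "\<dots> = A * B * (1 + L / H) + A * (A - 1) / H * exp (a * (w * exp ?z + 1))"
              using H by (simp add: field_simps)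
            also have "\<dots> \<le> C1 + C2 * ko y"
            proof (rule add_mono)
              show "A * B * (1 + L / H) \<le> C1" unfolding C1_def
                using A B L_pos r c by (intro mult_left_mono add_left_mono divide_left_mono) auto
              have "w * exp ?z + 1 \<le> w + exp (- ?z)"
                using True r by (intro add_mono) (auto intro: mult_left_le)
              then have "exp (a * (w * exp ?z + 1)) \<le> exp (a * (w + exp (- ?z)))" using a by simp
              also have "\<dots> \<le> ko y" unfolding ew_add by (rule ko_1[OF y])
              finally show "A * (A - 1) / H * exp (a * (w * exp ?z + 1)) \<le> C2 * ko y"
                unfolding C2_def using A r c
                by (intro mult_mono divide_left_mono) auto
            qed
            finally show ?thesis .
          next
            case False
            then have "\<Phi> (upper_step k s y) = C1 + C2 * (u ?z * exp (a * (w + exp (- ?z))))"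
              using 4 od by (simp add: s \<Phi>_def upper_step_def core_step_def next_phase_def)
            then show ?thesis using ko_u[OF y] C by (simp add: mult_left_mono)
          qed
          then show "0 \<le> \<Phi> (upper_step k s y) \<and> \<Phi> (upper_step k s y) \<le> C1 + C2 * ko y" using nn by simp
        qed
      next
        case 5
        have od: "2*k-1 \<noteq> 2*k" "2*k-1 \<noteq> 2*k+1" "\<not> 2*k+2 \<le> 2*k-1" using k by auto
        have small: "\<not> 2*k+2 \<le> j" "j \<noteq> 2*k+1" "j \<noteq> 2*k" "j \<noteq> 2*k-1" if "j < 2*k-1" for j
          using that by auto
        show ?thesis
        proof (rule nn_integral_le_bound[where k="\<lambda>y. C1 + C2 * A * exp a"])
          show "(\<integral>y. C1 + C2 * A * exp a \<partial>\<mu>) \<le> \<Phi> s" using small[OF 5] by (simp add: s \<Phi>_def)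
          fix y assume "\<bar>y\<bar> \<le> L"
          have "\<Phi> (upper_step k s y) \<le> C1 + C2 * A * exp a"
          proof (cases "next_phase (q, r, H) y = 2*k-1")
            case True
            let ?r = "max 0 (r + y)"
            \<comment> \<open>Accumulation starts from weight 0, so the first site gives at most 1;
              hence the factor \<open>exp a\<close> in the potential of all earlier phases.\<close>
            have "\<Phi> (upper_step k s y) = C1 + C2 * (u ?r * exp (a * exp (- ?r)))"
              using True 5 od r by (simp add: s \<Phi>_def upper_step_def core_step_def)
            also have "\<dots> \<le> C1 + C2 * (A * exp a)"
              using C a A by (intro add_left_mono mult_left_mono mult_mono) (auto simp: u_def)
            finally show ?thesis by (simp add: mult.assoc)
          next
            case False
            then have "next_phase (q, r, H) y < 2*k-1"
              using 5 by (auto simp: next_phase_def split: if_splits)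
            then show ?thesis using small[of "next_phase (q, r, H) y"]
              by (simp add: s \<Phi>_def upper_step_def core_step_def)
          qed
          then show "0 \<le> \<Phi> (upper_step k s y) \<and> \<Phi> (upper_step k s y) \<le> C1 + C2 * A * exp a" using nn by simp
        qed simp
      qed
    qed
    have "measure S {x \<in> space S. \<exists>n. T (run (upper_step k) ((0, 0, c), 0) x n)} \<le> \<Phi> ((0, 0, c), 0) / exp (a * b)"
    proof (rule run_absorbing_prob_le[where \<Phi>=\<Phi> and Inv=Inv, OF upper_step_measurable _ \<Phi> Inv_step step _ T])
      show "Inv ((0, 0, c), 0)" using c by (simp add: Inv_def core_inv_def)
      then show "0 \<le> \<Phi> ((0, 0, c), 0)" by (rule \<Phi>_nonneg)
      show "T (upper_step k s y)" if "T s" for s y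
        using that by (auto simp: T_def upper_step_def core_step_def next_phase_def)
    qed (use a in \<open>auto simp: space_pair_measure T_def \<Phi>_def\<close>)
    also have "\<Phi> ((0, 0, c), 0) = C1 + C2 * A * exp a" using k by (simp add: \<Phi>_def)
    finally show ?thesis by (simp add: T_def)
  qed
  show thesis
  proof (rule that[OF a])
    show "0 \<le> C1 + C2 * A * exp a" using C A by simp
    show "measure S {x \<in> space S. \<exists>n. 2*k+2 \<le> fst (fst (run (upper_step k) ((0, 0, c), 0) x n))
        \<and> b \<le> snd (run (upper_step k) ((0, 0, c), 0) x n)} \<le> (C1 + C2 * A * exp a) * exp (- a * b)"
      if "k \<ge> 1" for k b
      using bound[OF that, of b] by (simp add: exp_minus divide_inverse)
  qed
qed

end

section \<open>Wide valleys\<close>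

text \<open>
  In phase \<open>2 k\<close> the counter is reset to \<open>1\<close> at every new minimum and grows as long as the walk
  stays in \<open>[e, 3 L]\<close>; it drops to \<open>0\<close> when the walk leaves this strip, and is frozen as soon as it
  reaches \<open>t k\<close>. The flag is lost if some phase \<open>2 k\<close> with \<open>K \<le> k \<le> N\<close> ends with counter \<open>t k\<close>,
  or with a barrier below \<open>4 L + 1\<close>.
\<close>

definition lower_step :: "real \<Rightarrow> real \<Rightarrow> (nat \<Rightarrow> nat) \<Rightarrow> nat \<Rightarrow> nat \<Rightarrow>
    (nat \<times> real \<times> real) \<times> nat \<times> bool \<Rightarrow> real \<Rightarrow> (nat \<times> real \<times> real) \<times> nat \<times> bool" where
  "lower_step L e t K N s y = (core_step (fst s) y,
     (if odd (next_phase (fst s) y) then fst (snd s)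
      else if fst (snd (fst s)) + y \<le> 0 then 1
      else if t (fst (fst s) div 2) \<le> fst (snd s) then fst (snd s)
      else if 1 \<le> fst (snd s) \<and> e \<le> fst (snd (fst s)) + y \<and> fst (snd (fst s)) + y \<le> 3 * L
        then Suc (fst (snd s)) else 0),
     snd (snd s) \<and> \<not> (even (fst (fst s)) \<and> odd (next_phase (fst s) y)
       \<and> K \<le> fst (fst s) div 2 \<and> fst (fst s) div 2 \<le> N
       \<and> (t (fst (fst s) div 2) \<le> fst (snd s) \<or> snd (snd (fst s)) < 4 * L + 1)))"

abbreviation lower_space :: "((nat \<times> real \<times> real) \<times> nat \<times> bool) measure" where
  "lower_space \<equiv> core_space \<Otimes>\<^sub>M count_space UNIV \<Otimes>\<^sub>M count_space UNIV"

text \<open>Fixing the discrete components reduces measurability of a step to countably many maps in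
  which \<open>t\<close> and the parity tests are mere constants.\<close>

lemma measurable_compose_countable3:
  fixes f :: "'p \<Rightarrow> 'a :: countable" and g :: "'p \<Rightarrow> 'b :: countable" and h :: "'p \<Rightarrow> 'c :: countable"
  assumes "f \<in> M \<rightarrow>\<^sub>M count_space UNIV" "g \<in> M \<rightarrow>\<^sub>M count_space UNIV" "h \<in> M \<rightarrow>\<^sub>M count_space UNIV"
    and F: "\<And>a b c. F a b c \<in> M \<rightarrow>\<^sub>M N"
  shows "(\<lambda>p. F (f p) (g p) (h p) p) \<in> M \<rightarrow>\<^sub>M N"
  by (rule measurable_compose_countable[OF _ assms(1)], rule measurable_compose_countable[OF _ assms(2)],
      rule measurable_compose_countable[OF _ assms(3)], rule F)

lemma lower_step_measurable:
  "(\<lambda>(s, y). lower_step L e t K N s y) \<in> lower_space \<Otimes>\<^sub>M borel \<rightarrow>\<^sub>M lower_space"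
proof -
  let ?P = "lower_space \<Otimes>\<^sub>M borel :: (((nat \<times> real \<times> real) \<times> nat \<times> bool) \<times> real) measure"
  have pr: "(\<lambda>p. (fst (fst p), snd p)) \<in> ?P \<rightarrow>\<^sub>M core_space \<Otimes>\<^sub>M borel" by measurable
  have [measurable]: "(\<lambda>p. next_phase (fst (fst p)) (snd p)) \<in> ?P \<rightarrow>\<^sub>M count_space UNIV"
      "(\<lambda>p. core_step (fst (fst p)) (snd p)) \<in> ?P \<rightarrow>\<^sub>M core_space"
    using measurable_compose[OF pr next_phase_measurable] measurable_compose[OF pr core_step_measurable]
    by simp_all
  define F where "F q j al p = (core_step (fst (fst p)) (snd p),
     (if odd (next_phase (fst (fst p)) (snd p)) then j
      else if fst (snd (fst (fst p))) + snd p \<le> 0 then 1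
      else if t (q div 2) \<le> j then j
      else if 1 \<le> j \<and> e \<le> fst (snd (fst (fst p))) + snd p \<and> fst (snd (fst (fst p))) + snd p \<le> 3 * L
        then Suc j else 0),
     al \<and> \<not> (even q \<and> odd (next_phase (fst (fst p)) (snd p)) \<and> K \<le> q div 2 \<and> q div 2 \<le> N
       \<and> (t (q div 2) \<le> j \<or> snd (snd (fst (fst p))) < 4 * L + 1)))"
    for q j :: nat and al and p :: "((nat \<times> real \<times> real) \<times> nat \<times> bool) \<times> real"
  have F: "F q j al \<in> ?P \<rightarrow>\<^sub>M lower_space" for q j al
    unfolding F_def by measurable
  have "(\<lambda>(s, y). lower_step L e t K N s y)
      = (\<lambda>p. F (fst (fst (fst p))) (fst (snd (fst p))) (snd (snd (fst p))) p)"
    unfolding split_def lower_step_def F_def ..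
  then show ?thesis using measurable_compose_countable3[of _ ?P _ _ F, OF _ _ _ F] by simp
qed

lemma fst_lower_step: "fst (lower_step L e t K N s y) = core_step (fst s) y"
  by (simp add: lower_step_def)

lemma lower_run_core: "fst (run (lower_step L e t K N) ((0, 0, c), 1, True) x n) = core c x n"
  by (induction n) (simp_all add: core_def fst_lower_step)

text \<open>Each counted site lies at elevation at most \<open>3 * L\<close> and contributes at
  least \<open>exp (- 3 * L)\<close>. A new minimum shrinks the old weight, but there the counter
  restarts at 1 and the new site alone weighs 1.\<close>

lemma lower_run_count:
  assumes q: "phase c x n = 2 * k" and "L > 0"
  shows "exp (- 3 * L) * real (fst (snd (run (lower_step L e t K N) ((0, 0, c), 1, True) x n)))
    \<le> well_weight c x (2 * k) n"
  using q
proof (induction n)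
  case 0
  then show ?case using \<open>L > 0\<close> by (simp add: well_weight_0)
next
  case (Suc n)
  let ?s = "run (lower_step L e t K N) ((0, 0, c), 1, True) x n"
  let ?z = "elevation c x n + x n"
  have w: "well_weight c x (2 * k) (Suc n)
      = well_weight c x (2 * k) n * exp (min 0 ?z) + exp (- elevation c x (Suc n))"
    using Suc.prems by (simp add: well_weight_Suc)
  have w0: "0 \<le> well_weight c x (2 * k) n" by (simp add: well_weight_def sum_nonneg)
  have j: "fst (snd (run (lower_step L e t K N) ((0, 0, c), 1, True) x (Suc n))) =
     (if ?z \<le> 0 then 1 else if t (phase c x n div 2) \<le> fst (snd ?s) then fst (snd ?s)
      else if 1 \<le> fst (snd ?s) \<and> e \<le> ?z \<and> ?z \<le> 3 * L then Suc (fst (snd ?s)) else 0)"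
    unfolding run.simps lower_step_def[of L e t K N ?s] lower_run_core next_phase_core
    using Suc.prems by (simp add: core_eq)
  show ?case
  proof (cases "?z \<le> 0")
    case True
    have "exp (- 3 * L) \<le> 1" using \<open>L > 0\<close> by simp
    moreover have "1 \<le> well_weight c x (2 * k) (Suc n)"
      unfolding w using True w0 by (simp add: elevation_Suc)
    ultimately have "exp (- 3 * L) \<le> well_weight c x (2 * k) (Suc n)" by (rule order_trans)
    then show ?thesis unfolding j using True by simp
  next
    case False
    have "even (phase c x (Suc n))" using Suc.prems by simp
    then have "phase c x (Suc n) = phase c x n"
      using False unfolding phase_Suc[of c x n] by (auto split: if_splits)
    then have "phase c x n = 2 * k" using Suc.prems by simp
    then have IH: "exp (- 3 * L) * real (fst (snd ?s)) \<le> well_weight c x (2 * k) n" by (rule Suc.IH)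
    have w': "well_weight c x (2 * k) (Suc n) = well_weight c x (2 * k) n + exp (- ?z)"
      unfolding w using False by (simp add: elevation_Suc)
    have "fst (snd (run (lower_step L e t K N) ((0, 0, c), 1, True) x (Suc n))) \<le> fst (snd ?s)
      \<or> fst (snd (run (lower_step L e t K N) ((0, 0, c), 1, True) x (Suc n))) = Suc (fst (snd ?s)) \<and> ?z \<le> 3 * L"
      unfolding j using False by simp
    then consider "fst (snd (run (lower_step L e t K N) ((0, 0, c), 1, True) x (Suc n))) \<le> fst (snd ?s)"
      | "fst (snd (run (lower_step L e t K N) ((0, 0, c), 1, True) x (Suc n))) = Suc (fst (snd ?s))" "?z \<le> 3 * L"
      by blast
    then show ?thesis
    proof cases
      case 1
      then have "exp (- 3 * L) * real (fst (snd (run (lower_step L e t K N) ((0, 0, c), 1, True) x (Suc n))))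
          \<le> exp (- 3 * L) * real (fst (snd ?s))"
        by (intro mult_left_mono) auto
      also have "\<dots> \<le> well_weight c x (2 * k) (Suc n)" unfolding w' by (rule order_trans[OF IH]) simp
      finally show ?thesis .
    next
      case 2
      have "exp (- 3 * L) * real (Suc (fst (snd ?s))) = exp (- 3 * L) * real (fst (snd ?s)) + exp (- 3 * L)"
        by (simp add: algebra_simps)
      also have "\<dots> \<le> well_weight c x (2 * k) (Suc n)"
        unfolding w' using IH 2(2) by (intro add_mono) auto
      finally show ?thesis unfolding 2(1) .
    qed
  qed
qed

lemma lower_run_dead:
  assumes "\<not> snd (snd (run (lower_step L e t K N) ((0, 0, c), 1, True) x n))"
  obtains m k where "K \<le> k" "k \<le> N" "phase c x m = 2 * k" "phase c x (Suc m) = 2 * k + 1"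
    "t k \<le> fst (snd (run (lower_step L e t K N) ((0, 0, c), 1, True) x m)) \<or> barrier c x m < 4 * L + 1"
  using assms
proof (induction n arbitrary: thesis)
  case (Suc n)
  let ?s = "run (lower_step L e t K N) ((0, 0, c), 1, True) x n"
  show ?case
  proof (cases "snd (snd ?s)")
    case True
    have "snd (snd (lower_step L e t K N ?s (x n))) \<longleftrightarrow> snd (snd ?s) \<and> \<not> (even (phase c x n) \<and> odd (phase c x (Suc n))
       \<and> K \<le> phase c x n div 2 \<and> phase c x n div 2 \<le> N
       \<and> (t (phase c x n div 2) \<le> fst (snd ?s) \<or> barrier c x n < 4 * L + 1))"
      unfolding lower_step_def[of L e t K N ?s] lower_run_core next_phase_core by (simp add: core_eq)
    then have d: "even (phase c x n)" "odd (phase c x (Suc n))" "K \<le> phase c x n div 2" "phase c x n div 2 \<le> N"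
       "t (phase c x n div 2) \<le> fst (snd ?s) \<or> barrier c x n < 4 * L + 1"
      using Suc.prems(2) True by auto
    have "phase c x (Suc n) = Suc (phase c x n)" using phase_Suc_cases[of c x n] d by auto
    then show ?thesis using d by (intro Suc.prems(1)[of "phase c x n div 2" n]) auto
  qed (use Suc in blast)
qed simp

text \<open>The hypothesis on \<open>H\<close> rules out a loss of the flag by a low barrier, so
  only a full counter can be the cause.\<close>

lemma (in valley_path) effective_width_ge_if_dead:
  assumes "\<not> snd (snd (run (lower_step L e t K N) ((0, 0, c), 1, True) x n))"
    and "K \<ge> 1" "L > 0" and H: "\<And>m. 2 * K \<le> q m \<Longrightarrow> 4 * L + 1 \<le> H m"
  obtains k where "K \<le> k" "exp (- 3 * L) * real (t k) \<le> effective_width c V k"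
proof -
  obtain m k where mk: "K \<le> k" "k \<le> N" "q m = 2 * k" "q (Suc m) = 2 * k + 1"
    "t k \<le> fst (snd (run (lower_step L e t K N) ((0, 0, c), 1, True) x m)) \<or> H m < 4 * L + 1"
    using assms(1) by (rule lower_run_dead)
  have "exp (- 3 * L) * real (t k)
      \<le> exp (- 3 * L) * real (fst (snd (run (lower_step L e t K N) ((0, 0, c), 1, True) x m)))"
    using mk H[of m] by (intro mult_left_mono) auto
  also have "\<dots> \<le> well_weight c x (2 * k) m" by (rule lower_run_count) (use mk assms in auto)
  also have "\<dots> \<le> effective_width c V k" by (rule weight_le_effective_width) (use mk assms in auto)
  finally show thesis using mk(1) by (intro that[of k])
qed

section \<open>A supermartingale for the absence of wide valleys\<close>

context walk
begin

lemma integral_linear_step: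
  "integrable \<mu> (\<lambda>y. a + b * (r + y))" "(\<integral>y. a + b * (r + y) \<partial>\<mu>) = a + b * r"
  by (auto simp: step_mean)

text \<open>No independence between valleys is invoked: \<open>Q\<close> holds the product of the
  failure bounds still to come, and each relevant phase supplies its own factor through
  \<open>1 - G\<close>.\<close>

lemma lower_prob:
  assumes e: "0 < e" "e \<le> L" and p: "0 < p" "p < 1"
    and up: "p \<le> measure \<mu> {y. y \<ge> e}" and down: "p \<le> measure \<mu> {y. y \<le> - e}"
    and t: "\<And>k. 2 \<le> t k" and c: "0 < c" and K: "1 \<le> K"
  shows "measure S {x \<in> space S. \<exists>n. snd (snd (run (lower_step L e t K N) ((0, 0, c), 1, True) x n))
      \<and> 2 * N + 1 \<le> fst (fst (run (lower_step L e t K N) ((0, 0, c), 1, True) x n))}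
    \<le> (\<Prod>k=K..N. 1 - e / (2 * L) * p ^ (t k - 1))"
proof -
  define g where "g k = e / (2 * L) * p ^ (t k - 1)" for k
  \<comment> \<open>\<open>G\<close> bounds from below the probability that phase \<open>2 k\<close> ends with full counter: the first
    summand comes from returning to the minimum before reaching \<open>H\<close>, the second from completing
    the current count and then climbing to \<open>H\<close>.\<close>
  define \<beta> where "\<beta> k j = e / 2 * p ^ (t k - j)" for k j
  define G where "G k j r H = g k * (1 - r / H)
    + (if j = 0 then 0 else if j < t k then \<beta> k j / H else r / (H + L))" for k j and r H :: real
  define Q where "Q k = (\<Prod>i=max k K..N. 1 - g i)" for k
  \<comment> \<open>\<open>\<Psi>\<close> dominates the probability that the flag survives up to
    phase \<open>2 * N + 1\<close>. In a relevant even phase with a barrier below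
    \<open>4 * L + 1\<close> it is already 0: the barrier stays fixed until the phase ends, and then
    the flag is lost.\<close>
  define \<Psi> :: "(nat \<times> real \<times> real) \<times> nat \<times> bool \<Rightarrow> real" where
    "\<Psi> s = (if \<not> snd (snd s) then 0
       else if odd (fst (fst s)) then Q (Suc (fst (fst s)) div 2)
       else if K \<le> fst (fst s) div 2 \<and> fst (fst s) div 2 \<le> N
         then (if snd (snd (fst s)) < 4 * L + 1 then 0
               else (1 - G (fst (fst s) div 2) (fst (snd s)) (fst (snd (fst s))) (snd (snd (fst s))))
                 * Q (Suc (fst (fst s) div 2)))
       else Q (fst (fst s) div 2))" for s
  define Inv where "Inv s \<longleftrightarrow> core_inv c (fst s) \<and>
     (even (fst (fst s)) \<and> 1 \<le> fst (snd s) \<and> fst (snd s) < t (fst (fst s) div 2) \<longrightarrow>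
        fst (snd (fst s)) = 0 \<or> e \<le> fst (snd (fst s)) \<and> fst (snd (fst s)) \<le> 3 * L)"
    for s :: "(nat \<times> real \<times> real) \<times> nat \<times> bool"
  define T where "T s \<longleftrightarrow> snd (snd s) \<and> 2 * N + 1 \<le> fst (fst s)"
    for s :: "(nat \<times> real \<times> real) \<times> nat \<times> bool"
  note L = L_pos
  have g: "0 \<le> g k" "g k \<le> 1 / 2" for k
  proof -
    show "0 \<le> g k" using e p L by (simp add: g_def)
    have "e / (2 * L) * p ^ (t k - 1) \<le> 1 / 2 * 1"
      using e p L by (intro mult_mono power_le_one) (auto simp: field_simps)
    then show "g k \<le> 1 / 2" by (simp add: g_def)
  qed
  have \<beta>: "0 \<le> \<beta> k j" "\<beta> k j \<le> e / 2" for k j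
  proof -
    show "0 \<le> \<beta> k j" using e p by (simp add: \<beta>_def)
    have "p ^ (t k - j) \<le> 1" using p by (intro power_le_one) auto
    then show "\<beta> k j \<le> e / 2" using e by (simp add: \<beta>_def mult_left_le)
  qed
  \<comment> \<open>This identity dictates the factor \<open>e / (2 * L)\<close> in
    \<open>g\<close>. At a new minimum the linear part of \<open>G\<close>, extended to negative
    elevations, exceeds its value at 0 by at most \<open>g k * L / H\<close>, and the restarted
    counter supplies exactly \<open>\<beta> k 1 / H\<close>.\<close>
  have \<beta>1: "\<beta> k 1 = g k * L" for k using L by (simp add: \<beta>_def g_def)
  have \<beta>_Suc: "\<beta> k j = p * \<beta> k (Suc j)" if "j < t k" for k j
  proof -
    have "t k - j = Suc (t k - Suc j)" using that by simp
    then show ?thesis by (simp add: \<beta>_def)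
  qed
  have \<beta>_t: "\<beta> k (t k) = e / 2" for k by (simp add: \<beta>_def)
  have G_le_1: "G k j r H \<le> 1" if "0 \<le> r" "r < H" "4 * L + 1 \<le> H" for k j r H
  proof -
    have H: "0 < H" using that by simp
    have rH: "0 \<le> 1 - r / H" "1 - r / H \<le> 1" using that H by (auto simp: field_simps)
    show ?thesis
    proof (cases "j < t k \<or> j = 0")
      case True
      have "g k * (1 - r / H) \<le> 1 / 2 * 1" using g rH by (intro mult_mono) auto
      moreover have "\<beta> k j / H \<le> 1 / 2"
        using \<beta>(2)[of k j] e that H L by (simp add: field_simps)
      ultimately have "g k * (1 - r / H) + \<beta> k j / H \<le> 1" "g k * (1 - r / H) \<le> 1" by linarith+
      then show ?thesis using True by (auto simp: G_def)
    next
      case False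
      have "g k * (1 - r / H) \<le> 1 * (1 - r / H)" using g(2)[of k] rH by (intro mult_right_mono) auto
      moreover have "r / (H + L) \<le> r / H" using that H L by (intro divide_left_mono) auto
      ultimately show ?thesis using False by (auto simp: G_def)
    qed
  qed
  have Q: "0 \<le> Q k" for k
  proof -
    have "0 \<le> 1 - g i" for i using g(2)[of i] by linarith
    then show ?thesis unfolding Q_def by (intro prod_nonneg) auto
  qed
  have Q_step: "Q k = (1 - g k) * Q (Suc k)" if "K \<le> k" "k \<le> N" for k
    using that by (simp add: Q_def max_def prod.atLeast_Suc_atMost)
  have Q_out: "Q (Suc k) = Q k" if "\<not> (K \<le> k \<and> k \<le> N)" for k
    using that by (auto simp: Q_def max_def not_le)
  have Q_end: "Q k = 1" if "N < k" for k
    using that by (auto simp: Q_def max_def)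
  have Inv_step: "Inv (lower_step L e t K N s y)" if "Inv s" for s y
  proof -
    obtain q r H j al where s: "s = ((q, r, H), j, al)" by (metis prod_cases3 surj_pair)
    show ?thesis
      using that c core_inv_step[OF c, of "fst s" y] t[of "q div 2"]
      by (auto simp: Inv_def lower_step_def core_step_def next_phase_def s)
  qed
  have \<Psi>_nonneg: "0 \<le> \<Psi> s" if "Inv s" for s
    using that Q G_le_1 by (auto simp: \<Psi>_def Inv_def core_inv_def)
  have \<Psi>: "\<Psi> \<in> borel_measurable lower_space"
  proof -
    define F where "F q j al s = (if \<not> al then 0 else if odd q then Q (Suc q div 2)
       else if K \<le> q div 2 \<and> q div 2 \<le> N
         then (if snd (snd (fst s)) < 4 * L + 1 then 0
               else (1 - G (q div 2) j (fst (snd (fst s))) (snd (snd (fst s)))) * Q (Suc (q div 2)))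
       else Q (q div 2))" for q j and al :: bool and s :: "(nat \<times> real \<times> real) \<times> nat \<times> bool"
    have F: "F q j al \<in> borel_measurable lower_space" for q j al
      unfolding F_def G_def by measurable
    have "\<Psi> = (\<lambda>s. F (fst (fst s)) (fst (snd s)) (snd (snd s)) s)"
      unfolding \<Psi>_def F_def ..
    then show ?thesis using measurable_compose_countable3[of _ lower_space _ _ F, OF _ _ _ F] by simp
  qed
  have T: "Measurable.pred lower_space T" unfolding T_def by measurable
  have step: "(\<integral>\<^sup>+y. ennreal (\<Psi> (lower_step L e t K N s y)) \<partial>\<mu>) \<le> ennreal (\<Psi> s)" if I: "Inv s" for s
  proof -
    obtain q r H j al where s: "s = ((q, r, H), j, al)" by (metis prod_cases3 surj_pair)
    have inv: "0 \<le> r" "c \<le> H" "even q \<Longrightarrow> r < H" using I by (auto simp: s Inv_def core_inv_def)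
    have H: "0 < H" using inv c by simp
    have nn: "0 \<le> \<Psi> (lower_step L e t K N s y)" for y using I Inv_step \<Psi>_nonneg by blast
    have pointwise: ?thesis if "\<And>y. \<bar>y\<bar> \<le> L \<Longrightarrow> \<Psi> (lower_step L e t K N s y) \<le> \<Psi> s"
      by (rule nn_integral_le_bound[where k="\<lambda>y. \<Psi> s"]) (use that nn in auto)
    show ?thesis
    proof (cases al)
      case False
      then show ?thesis by (intro pointwise) (simp add: s \<Psi>_def lower_step_def)
    next
      case al: True
      show ?thesis
      proof (cases "even q")
        case False
        then obtain k' where k': "q = 2 * k' + 1" by (elim oddE)
        show ?thesis
        proof (rule pointwise)
          fix y
          let ?k = "Suc k'"
          have \<Psi>s: "\<Psi> s = Q ?k" by (simp add: s \<Psi>_def al k')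
          show "\<Psi> (lower_step L e t K N s y) \<le> \<Psi> s"
          proof (cases "r + y \<le> 0")
            case False
            then show ?thesis by (simp add: \<Psi>s s \<Psi>_def lower_step_def core_step_def next_phase_def al k')
          next
            case True
            then have nxt: "lower_step L e t K N s y = ((2 * ?k, 0, H), 1, True)"
              by (simp add: s lower_step_def core_step_def next_phase_def al k')
            show ?thesis
            proof (cases "K \<le> ?k \<and> ?k \<le> N")
              case out: False
              then show ?thesis unfolding \<Psi>s nxt by (auto simp: \<Psi>_def)
            next
              case in': True
              have "1 < t ?k" using t[of ?k] by simp
              then have "g ?k \<le> G ?k 1 0 H" using \<beta>(1)[of ?k 1] H by (simp add: G_def)
              then have "(1 - G ?k 1 0 H) * Q (Suc ?k) \<le> (1 - g ?k) * Q (Suc ?k)"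
                using Q by (intro mult_right_mono) auto
              also have "\<dots> = Q ?k" using Q_step[of ?k] in' by simp
              finally have "(1 - G ?k 1 0 H) * Q (Suc ?k) \<le> Q ?k" .
              then show ?thesis unfolding \<Psi>s nxt using in' Q[of ?k] by (simp add: \<Psi>_def)
            qed
          qed
        qed
      next
        case True
        then obtain k where k: "q = 2 * k" by (elim evenE)
        show ?thesis
        proof (cases "K \<le> k \<and> k \<le> N")
          case out: False
          have \<Psi>s: "\<Psi> s = Q k" using out by (auto simp: s \<Psi>_def al k)
          show ?thesis
          proof (rule pointwise)
            fix y
            show "\<Psi> (lower_step L e t K N s y) \<le> \<Psi> s"
              using out Q_out[OF out] unfolding \<Psi>s
              by (auto simp: s \<Psi>_def lower_step_def core_step_def next_phase_def al k)
          qed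
        next
          case in': True
          show ?thesis
          proof (cases "H < 4 * L + 1")
            case True
            have \<Psi>s: "\<Psi> s = 0" using in' True by (simp add: s \<Psi>_def al k)
            show ?thesis
            proof (rule pointwise)
              fix y
              show "\<Psi> (lower_step L e t K N s y) \<le> \<Psi> s"
                using in' True unfolding \<Psi>s
                by (simp add: s \<Psi>_def lower_step_def core_step_def next_phase_def al k)
            qed
          next
            case False
            then have H4: "4 * L + 1 \<le> H" by simp
            have rH: "r < H" using inv k by simp
            have \<Psi>s: "\<Psi> s = (1 - G k j r H) * Q (Suc k)"
              using in' False by (simp add: s \<Psi>_def al k)
            define A where "A = {y. e \<le> r + y \<and> r + y \<le> 3 * L}"
            have A [measurable]: "A \<in> sets \<mu>" unfolding A_def sets_step by measurable
            have pA: "p \<le> measure \<mu> A" if j: "1 \<le> j" "j < t k"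
            proof -
              have "r = 0 \<or> e \<le> r \<and> r \<le> 3 * L" using I j by (simp add: Inv_def s k)
              \<comment> \<open>The width of the strip: from at most \<open>2 * L\<close> an upward
                step of at least \<open>e\<close> stays in [\<open>e\<close>, \<open>3 * L\<close>],
                and from above \<open>2 * L\<close> a downward step of at least \<open>e\<close>
                does. So each attempt to count has probability at least \<open>p\<close>.\<close>
              then consider "r \<le> 2 * L" "r = 0 \<or> e \<le> r" | "2 * L < r" "r \<le> 3 * L" using e L by linarith
              then show ?thesis
              proof cases
                case 1
                have "measure \<mu> {y. y \<ge> e} \<le> measure \<mu> A"
                  by (rule finite_measure_mono_AE)
                     (use 1 e inv in \<open>auto simp: A_def intro!: eventually_mono[OF step_bounded]\<close>)
                then show ?thesis using up by simp
              next
                case 2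
                have "measure \<mu> {y. y \<le> - e} \<le> measure \<mu> A"
                  by (rule finite_measure_mono_AE)
                     (use 2 e inv in \<open>auto simp: A_def intro!: eventually_mono[OF step_bounded]\<close>)
                then show ?thesis using down by simp
              qed
            qed
            \<comment> \<open>\<open>lo\<close> lies below \<open>G\<close> after the step. Its
              linear parts are continued past 0 and \<open>H\<close>, so that centred steps
              integrate them exactly; for an incomplete counter only steps that are counted are
              credited.\<close>
            define ext where "ext y = (if j = 0 then 0 else if j < t k then \<beta> k (Suc j) / H * indicator A y
              else 0 + 1 / (H + L) * (r + y))" for y
            define lo where "lo y = (g k + - g k / H * (r + y)) + ext y" for y
            have indA: "integrable \<mu> (indicator A :: real \<Rightarrow> real)" "(\<integral>y. indicator A y \<partial>\<mu>) = measure \<mu> A"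
              using integrable_real_indicator[OF A] by (simp_all add: emeasure_eq_measure)
            have ext: "integrable \<mu> ext" unfolding ext_def
              using indA(1) integral_linear_step(1) by (cases "j = 0"; cases "j < t k") auto
            then have lo: "integrable \<mu> lo" unfolding lo_def
              by (intro Bochner_Integration.integrable_add integral_linear_step(1))
            have "(\<integral>y. lo y \<partial>\<mu>) = (g k + - g k / H * r) + (\<integral>y. ext y \<partial>\<mu>)"
              unfolding lo_def using ext integral_linear_step[of "g k" "- g k / H" r]
              by (subst Bochner_Integration.integral_add) auto
            moreover have "(if j = 0 then 0 else if j < t k then \<beta> k j / H else r / (H + L)) \<le> (\<integral>y. ext y \<partial>\<mu>)"
            proof -
              consider "j = 0" | "1 \<le> j" "j < t k" | "1 \<le> j" "t k \<le> j" by linarith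
              then show ?thesis
              proof cases
                case 1
                then show ?thesis by (simp add: ext_def)
              next
                case 2
                have "\<beta> k j / H = \<beta> k (Suc j) / H * p" using \<beta>_Suc[of j k] 2 by simp
                also have "\<dots> \<le> \<beta> k (Suc j) / H * measure \<mu> A"
                  using pA 2 \<beta>(1) H by (intro mult_left_mono) auto
                also have "\<dots> = (\<integral>y. \<beta> k (Suc j) / H * indicator A y \<partial>\<mu>)"
                  using indA by simp
                finally show ?thesis using 2 by (simp add: ext_def)
              next
                case 3
                then have "ext = (\<lambda>y. 0 + 1 / (H + L) * (r + y))" by (auto simp: ext_def)
                then have "(\<integral>y. ext y \<partial>\<mu>) = r / (H + L)"
                  using integral_linear_step(2)[of 0 "1 / (H + L)" r] by (simp only:) simp
                then show ?thesis using 3 by simp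
              qed
            qed
            ultimately have lo_int: "G k j r H \<le> (\<integral>y. lo y \<partial>\<mu>)"
              by (simp add: G_def algebra_simps)
            show ?thesis
            proof (rule nn_integral_le_bound[where k="\<lambda>y. (1 - lo y) * Q (Suc k)"])
              show "integrable \<mu> (\<lambda>y. (1 - lo y) * Q (Suc k))" using lo by simp
              have "(\<integral>y. (1 - lo y) * Q (Suc k) \<partial>\<mu>) = (1 - (\<integral>y. lo y \<partial>\<mu>)) * Q (Suc k)"
                using lo by simp
              also have "\<dots> \<le> \<Psi> s" unfolding \<Psi>s using lo_int Q by (intro mult_right_mono) auto
              finally show "(\<integral>y. (1 - lo y) * Q (Suc k) \<partial>\<mu>) \<le> \<Psi> s" .
              fix y assume y: "\<bar>y\<bar> \<le> L"
              let ?z = "r + y"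
              have lo_eq: "lo y = g k * (1 - ?z / H) + ext y"
                by (simp add: lo_def algebra_simps add_divide_distrib)
              have zHL: "?z \<le> H + L" using rH y by simp
              have "\<Psi> (lower_step L e t K N s y) \<le> (1 - lo y) * Q (Suc k)"
              proof (cases "H \<le> ?z")
                case True
                have "\<Psi> (lower_step L e t K N s y) = (1 - (if t k \<le> j then 1 else 0)) * Q (Suc k)"
                  using True H H4 in' by (simp add: s \<Psi>_def lower_step_def core_step_def next_phase_def al k)
                also have "\<dots> \<le> (1 - lo y) * Q (Suc k)"
                proof (rule mult_right_mono[OF _ Q])
                  have "1 - ?z / H \<le> 0" using True H by simp
                  then have "g k * (1 - ?z / H) \<le> 0" using g(1) by (simp add: mult_nonneg_nonpos)
                  \<comment> \<open>A counted step ends at most at \<open>3 * L\<close>, below the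
                    barrier, so only a full counter contributes at the exit; the denominator
                    \<open>H + L\<close> absorbs the overshoot.\<close>
                  moreover have "ext y \<le> (if t k \<le> j then 1 else 0)"
                    using True H4 L zHL H t[of k] by (auto simp: ext_def A_def indicator_def)
                  ultimately show "1 - (if t k \<le> j then 1 else 0) \<le> 1 - lo y" unfolding lo_eq by linarith
                qed
                finally show ?thesis .
              next
                case zH: False
                define j' where "j' = (if ?z \<le> 0 then 1 else if t k \<le> j then j
                  else if 1 \<le> j \<and> e \<le> ?z \<and> ?z \<le> 3 * L then Suc j else 0)"
                have "\<Psi> (lower_step L e t K N s y) = (1 - G k j' (max 0 ?z) H) * Q (Suc k)"
                  using zH H H4 in' False
                  by (simp add: s \<Psi>_def lower_step_def core_step_def next_phase_def al k j'_def del: One_nat_def)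
                also have "\<dots> \<le> (1 - lo y) * Q (Suc k)"
                proof (intro mult_right_mono[OF _ Q] diff_left_mono)
                  consider "?z \<le> 0" | "0 < ?z" "t k \<le> j" | "0 < ?z" "j < t k" "1 \<le> j" "e \<le> ?z" "?z \<le> 3 * L"
                    | "0 < ?z" "j < t k" "\<not> (1 \<le> j \<and> e \<le> ?z \<and> ?z \<le> 3 * L)" by linarith
                  then show "lo y \<le> G k j' (max 0 ?z) H"
                  proof cases
                    case 1
                    have "lo y \<le> g k * (1 - ?z / H)"
                      unfolding lo_eq using 1 e H L by (auto simp: ext_def A_def divide_nonpos_pos)
                    also have "\<dots> \<le> g k * (1 + L / H)"
                    proof (rule mult_left_mono)
                      have "- ?z \<le> L" using y inv by simp
                      then have "(- ?z) / H \<le> L / H" using H by (intro divide_right_mono) auto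
                      then have "- (?z / H) \<le> L / H" by (simp only: minus_divide_left)
                      then show "1 - ?z / H \<le> 1 + L / H" by linarith
                    qed (rule g(1))
                    also have "\<dots> = G k 1 0 H"
                      using t[of k] \<beta>1[of k] by (simp add: G_def algebra_simps)
                    finally show ?thesis using 1 by (simp add: j'_def)
                  next
                    case 2
                    then show ?thesis using t[of k] by (simp add: lo_eq ext_def j'_def G_def)
                  next
                    case 3
                    have ext3: "ext y = \<beta> k (Suc j) / H" using 3 by (simp add: ext_def A_def)
                    have j'3: "j' = Suc j" using 3 by (simp add: j'_def)
                    show ?thesis
                    proof (cases "Suc j = t k")
                      case True
                      \<comment> \<open>When the counter fills up, the walk is at least at
                        \<open>e\<close>, and \<open>H + L \<le> 2 * H\<close>. This is the origin
                        of the factor \<open>e / 2\<close> in \<open>\<beta>\<close>.\<close>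
                      have *: "e / 2 / H \<le> ?z / (H + L)"
                      proof -
                        have "e / 2 / H = e / (2 * H)" by simp
                        also have "\<dots> \<le> ?z / (H + L)" using 3 e H H4 L by (intro frac_le) auto
                        finally show ?thesis .
                      qed
                      show ?thesis using True * 3 unfolding lo_eq ext3 j'3 True \<beta>_t by (simp add: G_def)
                    next
                      case False
                      then show ?thesis using 3 unfolding lo_eq ext3 j'3 by (simp add: G_def)
                    qed
                  next
                    case 4
                    then have "ext y = 0" "j' = 0" by (auto simp: ext_def A_def j'_def)
                    then show ?thesis using 4 by (simp add: lo_eq G_def)
                  qed
                qed
                finally show ?thesis .
              qed
              then show "0 \<le> \<Psi> (lower_step L e t K N s y) \<and>
                  \<Psi> (lower_step L e t K N s y) \<le> (1 - lo y) * Q (Suc k)" using nn by simp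
            qed
          qed
        qed
      qed
    qed
  qed
  have a: "1 \<le> \<Psi> s" if "T s" for s
    using that Q_end by (auto simp: T_def \<Psi>_def)
  have "measure S {x \<in> space S. \<exists>n. T (run (lower_step L e t K N) ((0, 0, c), 1, True) x n)}
      \<le> \<Psi> ((0, 0, c), 1, True) / 1"
  proof (rule run_absorbing_prob_le[where \<Phi>=\<Psi> and Inv=Inv, OF lower_step_measurable _ \<Psi> Inv_step step _ T])
    show I0: "Inv ((0, 0, c), 1, True)" using c by (simp add: Inv_def core_inv_def)
    show "0 \<le> \<Psi> ((0, 0, c), 1, True)" using I0 by (rule \<Psi>_nonneg)
    show "T (lower_step L e t K N s y)" if "T s" for s y
      using that by (auto simp: T_def lower_step_def core_step_def next_phase_def)
  qed (use a in \<open>auto simp: space_pair_measure\<close>)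
  also have "\<Psi> ((0, 0, c), 1, True) = (\<Prod>k=K..N. 1 - g k)" using K by (simp add: \<Psi>_def Q_def)
  finally show ?thesis by (simp add: T_def g_def)
qed

end

section \<open>Almost sure logarithmic growth of the widths\<close>

context walk
begin

lemma AE_oscillating: "AE x in S. oscillating (walk_pos x)"
  using AE_walk_unbounded_signed[OF disjI1[OF refl]] AE_walk_unbounded_signed[OF disjI2[OF refl]]
  by eventually_elim (auto simp: oscillating_def)

lemma run_event_measurable:
  assumes f: "(\<lambda>(s, y). f s y) \<in> R \<Otimes>\<^sub>M borel \<rightarrow>\<^sub>M R" and R: "space R = UNIV"
    and T: "Measurable.pred R T"
  shows "{x \<in> space S. \<exists>n. T (run f s x n)} \<in> sets S"
proof -
  have r: "(\<lambda>x. run f s x n) \<in> S \<rightarrow>\<^sub>M R" for n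
    by (rule run_measurable[OF f]) (auto simp: R coordinate_measurable)
  have "{x \<in> space S. T (run f s x n)} \<in> sets S" for n
    using measurable_compose[OF r T] by (simp add: pred_def)
  then show ?thesis by (rule sets.sets_Collect_countable_Ex)
qed

lemma AE_width_upper:
  assumes c: "c > 0"
  obtains \<gamma> where "\<gamma> > 0"
    "AE x in S. \<forall>\<^sub>F k in sequentially. effective_width c (walk_pos x) k \<le> \<gamma> * ln (real k)"
proof -
  obtain a C where a: "a > 0" "C \<ge> 0" and tail: "\<And>k b. k \<ge> 1 \<Longrightarrow>
      measure S {x \<in> space S. \<exists>n. 2*k+2 \<le> fst (fst (run (upper_step k) ((0, 0, c), 0) x n))
        \<and> b \<le> snd (run (upper_step k) ((0, 0, c), 0) x n)} \<le> C * exp (- a * b)"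
    by (rule upper_tail[OF c], (rule that; assumption))
  \<comment> \<open>At the level \<open>\<gamma> * ln k\<close> the exponential tail becomes
    \<open>C / k\<^sup>2\<close>.\<close>
  define \<gamma> where "\<gamma> = 2 / a"
  define A where "A k = {x \<in> space S. \<exists>n. 2*k+2 \<le> fst (fst (run (upper_step k) ((0, 0, c), 0) x n))
        \<and> \<gamma> * ln (real k) \<le> snd (run (upper_step k) ((0, 0, c), 0) x n)}" for k
  have A: "A k \<in> sets S" for k
  proof -
    have "Measurable.pred (core_space \<Otimes>\<^sub>M borel) (\<lambda>s. 2*k+2 \<le> fst (fst s) \<and> \<gamma> * ln (real k) \<le> snd s)"
      by measurable
    from run_event_measurable[OF upper_step_measurable _ this] show ?thesis
      by (simp add: A_def space_pair_measure)
  qed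
  have le: "measure S (A (Suc k)) \<le> C * (1 / real (Suc k) ^ 2)" for k
  proof -
    have "measure S (A (Suc k)) \<le> C * exp (- a * (\<gamma> * ln (real (Suc k))))"
      unfolding A_def by (rule tail) simp
    also have "- a * (\<gamma> * ln (real (Suc k))) = - (2 * ln (real (Suc k)))" using a by (simp add: \<gamma>_def)
    also have "exp (- (2 * ln (real (Suc k)))) = 1 / real (Suc k) ^ 2"
      by (simp add: exp_minus exp_double power2_eq_square divide_inverse del: of_nat_Suc)
    finally show ?thesis .
  qed
  have "summable (\<lambda>k. measure S (A (Suc k)))"
  proof (rule summable_comparison_test')
    have "summable (\<lambda>k. 1 / real k ^ 2)" using inverse_power_summable[of 2, where 'a=real]
      by (simp add: divide_inverse)
    then have "summable (\<lambda>k. 1 / real (Suc k) ^ 2)" by (subst summable_Suc_iff)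
    then show "summable (\<lambda>k. C * (1 / real (Suc k) ^ 2))" by (rule summable_mult)
    show "norm (measure S (A (Suc k))) \<le> C * (1 / real (Suc k) ^ 2)" for k using le[of k] by simp
  qed
  then have "AE x in S. \<forall>\<^sub>F k in sequentially. x \<in> space S - A (Suc k)"
    by (intro borel_cantelli_AE1 A) (auto simp: seq.P.emeasure_eq_measure)
  then have "AE x in S. \<forall>\<^sub>F k in sequentially. effective_width c (walk_pos x) k \<le> \<gamma> * ln (real k)"
    using AE_oscillating
  proof eventually_elim
    case (elim x)
    interpret valley_path c x using c elim by unfold_locales
    have "\<forall>\<^sub>F k in sequentially. effective_width c V (Suc k) \<le> \<gamma> * ln (real (Suc k))"
      using elim(1)
    proof eventually_elim
      case (elim k)
      obtain n where n: "2 * Suc k + 2 \<le> q n" using phase_unbounded by blast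
      have "effective_width c V (Suc k) \<le> snd (run (upper_step (Suc k)) ((0, 0, c), 0) x n)"
        by (rule effective_width_le_upper_run) (use n in auto)
      moreover have "snd (run (upper_step (Suc k)) ((0, 0, c), 0) x n) < \<gamma> * ln (real (Suc k))"
        using elim n unfolding A_def upper_run_core phase_def by force
      ultimately show ?case by linarith
    qed
    then show ?case by (rule eventually_sequentially_Suc[THEN iffD1])
  qed
  then show thesis using a by (intro that[of \<gamma>]) (auto simp: \<gamma>_def)
qed

lemma AE_width_lower:
  assumes c: "c > 0"
  obtains \<gamma> where "\<gamma> > 0"
    "AE x in S. \<forall>k0. \<exists>k\<ge>k0. \<gamma> * ln (real k) \<le> effective_width c (walk_pos x) k"
proof -
  obtain e p where e: "0 < e" "e \<le> L" and p: "0 < p" "p < 1"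
    and up: "p \<le> measure \<mu> {y. y \<ge> e}" and down: "p \<le> measure \<mu> {y. y \<le> - e}"
    by (rule step_tails)
  define l where "l = - ln p"
  have l: "l > 0" using p by (simp add: l_def)
  \<comment> \<open>With this length \<open>p ^ (t k - 1)\<close> is at least \<open>p / k\<close>,
    while \<open>t k\<close> still exceeds \<open>ln k / l\<close>. The summand 2 also ensures that
    a counter restarted at 1 is not yet full.\<close>
  define t where "t k = 2 + nat \<lfloor>ln (real k) / l\<rfloor>" for k
  define \<gamma> where "\<gamma> = exp (- 3 * L) / l"
  have t2: "2 \<le> t k" for k by (simp add: t_def)
  have t_ge: "ln (real k) / l \<le> real (t k)" for k
    by (simp add: t_def) linarith
  define d where "d = e / (2 * L) * p"
  have d: "d > 0" using e p L_pos by (simp add: d_def)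
  have g_ge: "d / real k \<le> e / (2 * L) * p ^ (t k - 1)" if k: "1 \<le> k" for k
  proof -
    have "0 \<le> ln (real k) / l" using k l by simp
    then have "real (t k - 1) \<le> 1 + ln (real k) / l" by (simp add: t_def)
    then have "l * real (t k - 1) \<le> l * (1 + ln (real k) / l)" using l by (intro mult_left_mono) auto
    also have "\<dots> = l + ln (real k)" using l by (simp add: algebra_simps)
    finally have "ln p - ln (real k) \<le> real (t k - 1) * ln p" by (simp add: l_def algebra_simps)
    then have "exp (ln p - ln (real k)) \<le> exp (real (t k - 1) * ln p)" by simp
    also have "exp (ln p - ln (real k)) = p / real k" using p k by (simp add: exp_diff)
    also have "exp (real (t k - 1) * ln p) = p ^ (t k - 1)" using p by (simp add: exp_of_nat_mult)
    finally have "e / (2 * L) * (p / real k) \<le> e / (2 * L) * p ^ (t k - 1)"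
      using e L_pos by (intro mult_left_mono) auto
    then show ?thesis by (simp add: d_def)
  qed
  have prod_le: "(\<Prod>k=K..N. 1 - e / (2 * L) * p ^ (t k - 1)) \<le> exp (- d * (harm N - harm K))"
    if K: "1 \<le> K" "K \<le> N" for K N
  proof -
    have "(\<Prod>k=K..N. 1 - e / (2 * L) * p ^ (t k - 1)) \<le> (\<Prod>k=K..N. exp (- (d / real k)))"
    proof (rule prod_mono)
      fix k assume k: "k \<in> {K..N}"
      have "e / (2 * L) * p ^ (t k - 1) \<le> 1 * 1"
        using e p L_pos by (intro mult_mono power_le_one) (auto simp: field_simps)
      moreover have "1 - d / real k \<le> exp (- (d / real k))" using exp_ge_add_one_self[of "- (d / real k)"] by simp
      ultimately show "0 \<le> 1 - e / (2 * L) * p ^ (t k - 1) \<and> 1 - e / (2 * L) * p ^ (t k - 1) \<le> exp (- (d / real k))"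
        using g_ge[of k] k K by auto
    qed
    also have "\<dots> = exp (- d * (\<Sum>k=K..N. inverse (real k)))"
      by (simp add: exp_sum[symmetric] sum_distrib_left sum_negf divide_inverse)
    also have "\<dots> \<le> exp (- d * (harm N - harm K))"
    proof -
      have "harm N = (\<Sum>k\<in>{1..K} \<union> {K<..N}. inverse (real k))"
        unfolding harm_def using K by (intro sum.cong) auto
      also have "\<dots> = harm K + (\<Sum>k\<in>{K<..N}. inverse (real k))"
        unfolding harm_def by (rule sum.union_disjoint) auto
      also have "(\<Sum>k\<in>{K<..N}. inverse (real k)) \<le> (\<Sum>k=K..N. inverse (real k))"
        by (rule sum_mono2) auto
      finally show ?thesis using d by simp
    qed
    finally show ?thesis .
  qed
  define D where "D K N = {x \<in> space S. \<exists>n. snd (snd (run (lower_step L e t K N) ((0, 0, c), 1, True) x n))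
      \<and> 2 * N + 1 \<le> fst (fst (run (lower_step L e t K N) ((0, 0, c), 1, True) x n))}" for K N
  have D: "D K N \<in> sets S" for K N
  proof -
    have "Measurable.pred lower_space (\<lambda>s. snd (snd s) \<and> 2 * N + 1 \<le> fst (fst s))"
      by measurable
    from run_event_measurable[OF lower_step_measurable _ this] show ?thesis
      by (simp add: D_def space_pair_measure)
  qed
  \<comment> \<open>The survival bounds tend to 0 because the harmonic series diverges. Thus for
    each starting index \<open>K\<close> the flag is almost surely lost for some \<open>N\<close>,
    which replaces the second Borel-Cantelli lemma.\<close>
  have null: "AE x in S. \<exists>N. x \<notin> D (Suc K) N" for K
  proof -
    have "measure S (\<Inter>N. D (Suc K) N) \<le> 0"
    proof (rule LIMSEQ_le_const)
      have "filterlim (\<lambda>N. - harm (Suc K) + harm N :: real) at_top sequentially"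
        by (rule filterlim_tendsto_add_at_top[OF tendsto_const harm_at_top])
      then have "filterlim (\<lambda>N. d * (- harm (Suc K) + harm N)) at_top sequentially"
        using d by (intro filterlim_tendsto_pos_mult_at_top[OF tendsto_const])
      then have "filterlim (\<lambda>N. - (d * (- harm (Suc K) + harm N))) at_bot sequentially"
        by (simp add: filterlim_uminus_at_bot)
      then have "(\<lambda>N. exp (- (d * (- harm (Suc K) + harm N)))) \<longlonglongrightarrow> 0"
        by (rule filterlim_compose[OF exp_at_bot])
      then show "(\<lambda>N. exp (- d * (harm N - harm (Suc K)))) \<longlonglongrightarrow> 0" by (simp add: algebra_simps)
      have "measure S (\<Inter>N. D (Suc K) N) \<le> exp (- d * (harm N - harm (Suc K)))" if "Suc K \<le> N" for N
      proof -
        have "measure S (\<Inter>N. D (Suc K) N) \<le> measure S (D (Suc K) N)"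
          by (rule seq.P.finite_measure_mono) (use D in auto)
        also have "\<dots> \<le> (\<Prod>k=Suc K..N. 1 - e / (2 * L) * p ^ (t k - 1))"
          unfolding D_def by (rule lower_prob[OF e p up down t2 c]) simp
        also have "\<dots> \<le> exp (- d * (harm N - harm (Suc K)))" using that by (intro prod_le) auto
        finally show ?thesis .
      qed
      then show "\<exists>M. \<forall>N\<ge>M. measure S (\<Inter>N. D (Suc K) N) \<le> exp (- d * (harm N - harm (Suc K)))" by blast
    qed
    then have "emeasure S (\<Inter>N. D (Suc K) N) = 0"
      by (simp add: seq.P.emeasure_eq_measure measure_le_0_iff)
    moreover have "(\<Inter>N. D (Suc K) N) \<in> sets S" using D by auto
    ultimately have "AE x in S. x \<notin> (\<Inter>N. D (Suc K) N)" by (intro AE_not_in) (auto simp: null_sets_def)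
    then show ?thesis by (rule eventually_mono) auto
  qed
  then have "AE x in S. \<forall>K. \<exists>N. x \<notin> D (Suc K) N" by (simp add: AE_all_countable)
  then have "AE x in S. \<forall>k0. \<exists>k\<ge>k0. \<gamma> * ln (real k) \<le> effective_width c (walk_pos x) k"
    using AE_oscillating AE_space
  proof eventually_elim
    case (elim x)
    interpret valley_path c x using c elim by unfold_locales
    show ?case
    proof
      fix k0
      obtain m0 where m0: "4 * L + 1 \<le> H m0" using barrier_unbounded by blast
      \<comment> \<open>\<open>K\<close> depends on the path: from phase \<open>2 * Suc K\<close> on
        the barrier is at least \<open>4 * L + 1\<close>. This is legitimate because one null set
        serves all starting indices.\<close>
      define K where "K = k0 + q m0"
      have HK: "4 * L + 1 \<le> H m" if "2 * Suc K \<le> q m" for m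
      proof -
        have "q m0 < q m" using that by (simp add: K_def)
        then have "m0 \<le> m" using phase_mono[of m m0 c x] by (cases "m \<le> m0") auto
        then show ?thesis using barrier_mono[of m0 m c x] m0 by linarith
      qed
      obtain N where N: "x \<notin> D (Suc K) N" using elim by blast
      obtain n where "2 * N + 1 \<le> q n" using phase_unbounded by blast
      then have "\<not> snd (snd (run (lower_step L e t (Suc K) N) ((0, 0, c), 1, True) x n))"
        using N elim(3) unfolding D_def lower_run_core phase_def by blast
      then obtain k where k: "Suc K \<le> k" "exp (- 3 * L) * real (t k) \<le> effective_width c V k"
        by (rule effective_width_ge_if_dead) (use L_pos HK in auto)
      have "\<gamma> * ln (real k) = exp (- 3 * L) * (ln (real k) / l)" by (simp add: \<gamma>_def)
      also have "\<dots> \<le> exp (- 3 * L) * real (t k)" using t_ge by (intro mult_left_mono) auto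
      finally show "\<exists>k\<ge>k0. \<gamma> * ln (real k) \<le> effective_width c V k"
        using k by (intro exI[of _ k]) (auto simp: K_def)
    qed
  qed
  then show thesis using l by (intro that[of \<gamma>]) (auto simp: \<gamma>_def)
qed

end

section \<open>From single widths to the limsup of their maxima\<close>

lemma limsup_Max_over_ln_le:
  fixes W :: "nat \<Rightarrow> real"
  assumes \<gamma>: "\<gamma> > 0" and W: "\<forall>\<^sub>F k in sequentially. W k \<le> \<gamma> * ln (real k)"
  shows "limsup (\<lambda>N. ereal (1 / ln (real N) * Max (W ` {1..N}))) \<le> ereal \<gamma>"
proof (rule Limsup_bounded)
  obtain k0 where k0: "\<And>k. k \<ge> k0 \<Longrightarrow> W k \<le> \<gamma> * ln (real k)"
    using W by (auto simp: eventually_sequentially)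
  define B where "B = Max (W ` {..k0})"
  have "filterlim (\<lambda>N. \<gamma> * ln (real N)) at_top sequentially"
    using \<gamma> by (intro filterlim_tendsto_pos_mult_at_top[OF tendsto_const]
        filterlim_compose[OF ln_at_top filterlim_real_sequentially])
  then have "\<forall>\<^sub>F N in sequentially. B \<le> \<gamma> * ln (real N)" by (simp add: filterlim_at_top)
  then show "\<forall>\<^sub>F N in sequentially. ereal (1 / ln (real N) * Max (W ` {1..N})) \<le> ereal \<gamma>"
    using eventually_ge_at_top[of 2]
  proof eventually_elim
    case (elim N)
    have ln: "ln (real N) > 0" using elim by simp
    have "Max (W ` {1..N}) \<le> \<gamma> * ln (real N)"
    proof (rule Max.boundedI)
      fix w assume "w \<in> W ` {1..N}"
      then obtain k where k: "1 \<le> k" "k \<le> N" "w = W k" by auto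
      show "w \<le> \<gamma> * ln (real N)"
      proof (cases "k0 \<le> k")
        case True
        have "\<gamma> * ln (real k) \<le> \<gamma> * ln (real N)" using k \<gamma> by (intro mult_left_mono) auto
        then show ?thesis using k0[OF True] k by linarith
      next
        case False
        then have "W k \<le> B" unfolding B_def by (intro Max_ge) auto
        then show ?thesis using elim k by linarith
      qed
    qed (use elim in auto)
    then show ?case using ln by (simp add: field_simps)
  qed
qed

text \<open>Each wide index \<open>k\<close> is tested at N = \<open>k\<close>, where the maximum
  includes \<open>W k\<close> and the normalisation is \<open>ln k\<close>.\<close>

lemma limsup_Max_over_ln_ge:
  fixes W :: "nat \<Rightarrow> real"
  assumes W: "\<forall>k0. \<exists>k\<ge>k0. \<gamma> * ln (real k) \<le> W k"
  shows "ereal \<gamma> \<le> limsup (\<lambda>N. ereal (1 / ln (real N) * Max (W ` {1..N})))"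
proof (rule ccontr)
  assume "\<not> ?thesis"
  then have "\<forall>\<^sub>F N in sequentially. ereal (1 / ln (real N) * Max (W ` {1..N})) < ereal \<gamma>"
    by (intro Limsup_lessD) simp
  then obtain N0 where N0: "\<And>N. N \<ge> N0 \<Longrightarrow> 1 / ln (real N) * Max (W ` {1..N}) < \<gamma>"
    by (auto simp: eventually_sequentially)
  obtain k where k: "k \<ge> max N0 2" "\<gamma> * ln (real k) \<le> W k" using W by blast
  have ln: "ln (real k) > 0" using k by simp
  have "W k \<le> Max (W ` {1..k})" using k by (intro Max_ge) auto
  then have "\<gamma> * ln (real k) \<le> Max (W ` {1..k})" using k by linarith
  moreover have "Max (W ` {1..k}) < \<gamma> * ln (real k)"
    using N0[of k] k ln by (simp add: pos_divide_less_eq del: Max_less_iff)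
  ultimately show False by linarith
qed

lemma (in walk) AE_limsup_width:
  assumes c: "c > 0"
  obtains \<gamma>m \<gamma>p :: real where "0 < \<gamma>m" "\<gamma>m \<le> \<gamma>p"
    "AE x in S. ereal \<gamma>m \<le> limsup (\<lambda>N. ereal (1 / ln (real N) * Max (effective_width c (walk_pos x) ` {1..N})))
       \<and> limsup (\<lambda>N. ereal (1 / ln (real N) * Max (effective_width c (walk_pos x) ` {1..N}))) \<le> ereal \<gamma>p"
proof -
  obtain a where a: "a > 0"
    "AE x in S. \<forall>\<^sub>F k in sequentially. effective_width c (walk_pos x) k \<le> a * ln (real k)"
    using AE_width_upper[OF c] .
  obtain b where b: "b > 0"
    "AE x in S. \<forall>k0. \<exists>k\<ge>k0. b * ln (real k) \<le> effective_width c (walk_pos x) k"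
    using AE_width_lower[OF c] .
  show thesis
  \<comment> \<open>Taking the maximum gives the order of the two constants without comparing the
    estimates behind them.\<close>
  proof (rule that[of b "max a b"])
    show "AE x in S. ereal b \<le> limsup (\<lambda>N. ereal (1 / ln (real N) * Max (effective_width c (walk_pos x) ` {1..N})))
       \<and> limsup (\<lambda>N. ereal (1 / ln (real N) * Max (effective_width c (walk_pos x) ` {1..N}))) \<le> ereal (max a b)"
      using a(2) b(2)
    proof eventually_elim
      case (elim x)
      have "limsup (\<lambda>N. ereal (1 / ln (real N) * Max (effective_width c (walk_pos x) ` {1..N}))) \<le> ereal a"
        by (rule limsup_Max_over_ln_le[OF a(1) elim(1)])
      also have "\<dots> \<le> ereal (max a b)" by simp
      finally show ?case using limsup_Max_over_ln_ge[OF elim(2)] by simp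
    qed
  qed (use b in auto)
qed

text \<open>The potential starts with the step at site 1, the coordinate sequence with index 0; the
  product law is invariant under the shift between them.\<close>

lemma (in walk) AE_shift:
  assumes "AE x in S. P x"
  shows "AE x in S. P (\<lambda>i. x (Suc i))"
proof -
  have eq: "distr S S (\<lambda>x. \<lambda>i\<in>UNIV. x (Suc i)) = S"
    using distr_PiM_reindex[of UNIV "\<lambda>_. \<mu>" Suc UNIV] prob_space_axioms by simp
  have "AE x in distr S S (\<lambda>x. \<lambda>i\<in>UNIV. x (Suc i)). P x" unfolding eq by (rule assms)
  then have "AE x in S. P (\<lambda>i\<in>UNIV. x (Suc i))" by (rule AE_distrD[rotated]) measurable
  then show ?thesis by (simp add: restrict_def)
qed

lemma potential_eq_walk_pos: "potential e = walk_pos (\<lambda>i. ln (rho e (Suc i)))"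
  by (rule ext) (simp add: potential_def walk_pos_def sum.atLeast1_atMost_eq)

theorem proposition4p6:
  fixes M :: "'a measure" and \<omega> :: "nat \<Rightarrow> 'a \<Rightarrow> real" and \<delta> K0 :: real
  assumes "prob_space M"
    and "prob_space.indep_vars M (\<lambda>_. borel) \<omega> UNIV"
    and "\<And>x. distr M borel (\<omega> x) = distr M borel (\<omega> 0)"
    and "\<And>x \<xi>. \<xi> \<in> space M \<Longrightarrow> 0 < \<omega> x \<xi> \<and> \<omega> x \<xi> < 1"
    and "prob_space.expectation M (\<lambda>\<xi>. ln (rho (\<lambda>x. \<omega> x \<xi>) 1)) = 0"
    and "prob_space.variance M (\<lambda>\<xi>. ln (rho (\<lambda>x. \<omega> x \<xi>) 1)) > 0"
    and "0 < \<delta>" and "\<delta> < 1"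
    and "AE \<xi> in M. \<delta> \<le> \<omega> 1 \<xi> \<and> \<omega> 1 \<xi> \<le> 1 - \<delta>"
    and "K0 > 0"
  shows "\<exists>\<gamma>m \<gamma>p :: real. 0 < \<gamma>m \<and> \<gamma>m \<le> \<gamma>p \<and>
    (AE \<xi> in M.
       ereal \<gamma>m \<le> limsup (\<lambda>N. ereal (1 / ln (real N) *
         Max (effective_width K0 (potential (\<lambda>x. \<omega> x \<xi>)) ` {1..N}))) \<and>
       limsup (\<lambda>N. ereal (1 / ln (real N) *
         Max (effective_width K0 (potential (\<lambda>x. \<omega> x \<xi>)) ` {1..N}))) \<le> ereal \<gamma>p)"
proof -
  interpret prob_space M by fact
  have [measurable]: "\<omega> i \<in> borel_measurable M" for i
    using assms(2) by (auto simp: indep_vars_def)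
  define h :: "real \<Rightarrow> real" where "h w = ln ((1 - w) / w)" for w
  have [measurable]: "h \<in> borel_measurable borel" unfolding h_def by measurable
  define X where "X i \<xi> = h (\<omega> i \<xi>)" for i \<xi>
  have [measurable]: "X i \<in> borel_measurable M" for i unfolding X_def by measurable
  have ln_rho: "ln (rho (\<lambda>x. \<omega> x \<xi>) i) = X i \<xi>" for i \<xi> by (simp add: rho_def X_def h_def)
  define \<mu> where "\<mu> = distr M borel (X 1)"
  have law: "distr M borel (X i) = \<mu>" for i
  proof -
    have "distr M borel (X i) = distr (distr M borel (\<omega> i)) borel h" for i
      by (simp add: distr_distr comp_def X_def[abs_def])
    then show ?thesis unfolding \<mu>_def using assms(3)[of i] assms(3)[of 1] by simp
  qed
  \<comment> \<open>Ellipticity puts \<open>ln w\<close> and \<open>ln (1 - w)\<close> in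
    [\<open>ln \<delta>\<close>, 0], so their difference is at most \<open>- ln \<delta>\<close> in
    absolute value.\<close>
  define L where "L = - ln \<delta>"
  have "AE \<xi> in M. \<bar>X 1 \<xi>\<bar> \<le> L"
    using assms(9)
  proof eventually_elim
    case (elim \<xi>)
    let ?w = "\<omega> 1 \<xi>"
    have w: "\<delta> \<le> ?w" "\<delta> \<le> 1 - ?w" "?w \<le> 1" "0 < ?w" "0 < 1 - ?w" using elim assms(7) by auto
    have "X 1 \<xi> = ln (1 - ?w) - ln ?w" using w by (simp add: X_def h_def ln_div)
    moreover have "ln \<delta> \<le> ln ?w" "ln \<delta> \<le> ln (1 - ?w)" "ln ?w \<le> 0" "ln (1 - ?w) \<le> 0"
      using w assms(7) by simp_all
    ultimately show ?case by (simp add: L_def)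
  qed
  then have bounded: "AE y in \<mu>. \<bar>y\<bar> \<le> L"
    unfolding \<mu>_def by (subst AE_distr_iff) auto
  have mean: "expectation (X 1) = 0"
    using assms(5) unfolding ln_rho .
  have var: "variance (X 1) > 0"
    using assms(6) unfolding ln_rho .
  interpret w: walk \<mu> L
  proof (intro walk.intro walk_axioms.intro)
    show "prob_space \<mu>" unfolding \<mu>_def by (rule prob_space_distr) simp
    show "sets \<mu> = sets borel" by (simp add: \<mu>_def)
    show "L > 0" using assms(7,8) by (simp add: L_def)
    show "AE y in \<mu>. \<bar>y\<bar> \<le> L" by (rule bounded)
    show "(\<integral>y. y \<partial>\<mu>) = 0" unfolding \<mu>_def using mean by (simp add: integral_distr)
    show "\<not> (AE y in \<mu>. y = 0)"
    proof
      assume "AE y in \<mu>. y = 0"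
      then have "AE \<xi> in M. X 1 \<xi> = 0" unfolding \<mu>_def by (subst (asm) AE_distr_iff) auto
      then have "AE \<xi> in M. (X 1 \<xi> - expectation (X 1))\<^sup>2 = 0" unfolding mean by (rule eventually_mono) simp
      then have "variance (X 1) = 0" by (rule integral_eq_zero_AE)
      then show False using var by simp
    qed
  qed
  have "indep_vars (\<lambda>_. borel) (\<lambda>i \<xi>. h (\<omega> i \<xi>)) UNIV"
    by (rule indep_vars_compose2[OF assms(2)]) simp
  then have "indep_vars (\<lambda>_. borel) X UNIV" by (simp add: X_def[abs_def])
  then have "distr M (\<Pi>\<^sub>M i\<in>UNIV. borel) (\<lambda>\<xi>. \<lambda>i\<in>UNIV. X i \<xi>) = (\<Pi>\<^sub>M i\<in>UNIV. distr M borel (X i))"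
    by (subst (asm) indep_vars_iff_distr_eq_PiM) auto
  then have S: "distr M (\<Pi>\<^sub>M i\<in>UNIV. borel) (\<lambda>\<xi> i. X i \<xi>) = w.S"
    by (simp add: law restrict_def)
  obtain \<gamma>m \<gamma>p :: real where \<gamma>: "0 < \<gamma>m" "\<gamma>m \<le> \<gamma>p"
    and lim: "AE x in w.S. ereal \<gamma>m \<le> limsup (\<lambda>N. ereal (1 / ln (real N) * Max (effective_width K0 (walk_pos x) ` {1..N})))
       \<and> limsup (\<lambda>N. ereal (1 / ln (real N) * Max (effective_width K0 (walk_pos x) ` {1..N}))) \<le> ereal \<gamma>p"
    by (rule w.AE_limsup_width[OF assms(10)])
  have "AE \<xi> in M. ereal \<gamma>m \<le> limsup (\<lambda>N. ereal (1 / ln (real N) *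
         Max (effective_width K0 (potential (\<lambda>x. \<omega> x \<xi>)) ` {1..N}))) \<and>
       limsup (\<lambda>N. ereal (1 / ln (real N) *
         Max (effective_width K0 (potential (\<lambda>x. \<omega> x \<xi>)) ` {1..N}))) \<le> ereal \<gamma>p"
    unfolding potential_eq_walk_pos ln_rho
    by (rule AE_distrD[of "\<lambda>\<xi> i. X i \<xi>" M "\<Pi>\<^sub>M i\<in>UNIV. borel", unfolded S, OF _ w.AE_shift[OF lim]])
       (rule measurable_PiM_single', auto)
  with \<gamma> show ?thesis by blast
qed

end
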